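(* Let $G$ be a strongly polycyclic group. Then, for every finite set $S \subset G$, there exists an invariant $S$-midpointed decidable convex geometry on $G$.
   Context: The strongly polycyclic groups are the smallest family of groups containing the trivial group and such that $G$ is strongly polycyclic whenever there is an exact sequence $1 \to K \to G \to \mathbb{Z} \to 1$ with $K$ strongly polycyclic. Let $\mathrm{FinSet}(G)$ be the set of finite subsets of $G$. A family $\mathcal{C} \subset \mathrm{FinSet}(G)$ is a convex geometry if $\mathcal{C} = \{\tau(B) : B \in \mathrm{FinSet}(G)\}$ for a map $\tau : \mathrm{FinSet}(G) \to \mathrm{FinSet}(G)$ with $\tau(\emptyset) = \emptyset$, $B \subset \tau(B)$, $B \subset B' \implies \tau(B) \subset \tau(B')$, $\tau(\tau(B)) = \tau(B)$, and such that the anti-exchange axiom holds: if $C \in \mathcal{C}$, $y \neq z$, $C \cap \{y,z\} = \emptyset$ and $y \in \tau(C \cup \{z\})$, then $z \notin \tau(C \cup \{y\})$. It is invariant if $C \in \mathcal{C}$ implies $gC \in \mathcal{C}$ for all $g \in G$. For $S \subset G$, it is $S$-midpointed if $g \in \tau(\{gh, gh^{-1}\})$ for all $g \in G$ and $h \in S$. Decidable: $G$ is finitely generated with decidable word problem, and elements are encoded as words with respect to any encoding for which the set of codes is decidable and product and inversion are computable (unique up to computable bijection); finite subsets of $G$ are encoded in the standard way, and $\mathcal{C}$ is decidable if membership of a given finite set in $\mathcal{C}$ is decidable. *)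

theory Defs
  imports "HOL-Algebra.Elementary_Groups" "HOL-Library.Nat_Bijection"
begin

section \<open>Strongly polycyclic groups\<close>

text \<open>
  In an extension \<open>1 \<rightarrow> K \<rightarrow> G \<rightarrow> \<int> \<rightarrow> 1\<close> the kernel group \<open>K\<close> embeds into \<open>G\<close>, so up to
  isomorphism it has the element type of \<open>G\<close>; using a single element type loses no groups.
\<close>

inductive strongly_polycyclic :: "'a monoid \<Rightarrow> bool" where
  trivial: "trivial_group G \<Longrightarrow> strongly_polycyclic G"
| extension:
    "\<lbrakk>group K; group G; strongly_polycyclic K;
      i \<in> mon K G; p \<in> epi G integer_group;
      i ` carrier K = kernel G integer_group p\<rbrakk>
     \<Longrightarrow> strongly_polycyclic G"

section \<open>Convex geometries\<close>

text \<open>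
  \<open>\<tau>\<close> matters only on \<open>Fpow (carrier G)\<close>, where it is determined by \<open>\<C>\<close>:
  \<open>\<tau> B\<close> is the least member of \<open>\<C>\<close> that contains \<open>B\<close>.
\<close>

definition convex_geometry ::
    "'a monoid \<Rightarrow> 'a set set \<Rightarrow> ('a set \<Rightarrow> 'a set) \<Rightarrow> bool" where
  "convex_geometry G \<C> \<tau> \<longleftrightarrow>
     \<tau> \<in> Fpow (carrier G) \<rightarrow> Fpow (carrier G) \<and>
     \<C> = \<tau> ` Fpow (carrier G) \<and>
     \<tau> {} = {} \<and>
     (\<forall>B\<in>Fpow (carrier G). B \<subseteq> \<tau> B) \<and>
     (\<forall>B\<in>Fpow (carrier G). \<forall>B'\<in>Fpow (carrier G). B \<subseteq> B' \<longrightarrow> \<tau> B \<subseteq> \<tau> B') \<and>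
     (\<forall>B\<in>Fpow (carrier G). \<tau> (\<tau> B) = \<tau> B) \<and>
     (\<forall>C\<in>\<C>. \<forall>y\<in>carrier G. \<forall>z\<in>carrier G.
        y \<noteq> z \<and> C \<inter> {y, z} = {} \<and> y \<in> \<tau> (C \<union> {z}) \<longrightarrow> z \<notin> \<tau> (C \<union> {y}))"

definition invariant_family :: "'a monoid \<Rightarrow> 'a set set \<Rightarrow> bool" where
  "invariant_family G \<C> \<longleftrightarrow> (\<forall>C\<in>\<C>. \<forall>g\<in>carrier G. g <#\<^bsub>G\<^esub> C \<in> \<C>)"

definition midpointed :: "'a monoid \<Rightarrow> 'a set \<Rightarrow> ('a set \<Rightarrow> 'a set) \<Rightarrow> bool" where
  "midpointed G S \<tau> \<longleftrightarrow>
     (\<forall>g\<in>carrier G. \<forall>h\<in>S. g \<in> \<tau> {g \<otimes>\<^bsub>G\<^esub> h, g \<otimes>\<^bsub>G\<^esub> inv\<^bsub>G\<^esub> h})"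

section \<open>Total recursive functions\<close>

text \<open>
  \<open>total_recursive n f\<close>: the function \<open>f\<close> of \<open>n\<close> arguments, given as a list, is total recursive.
  Only the values of \<open>f\<close> on lists of length \<open>n\<close> are meaningful. Minimisation is restricted to
  regular functions, which yields exactly the total computable functions.
\<close>

inductive total_recursive :: "nat \<Rightarrow> (nat list \<Rightarrow> nat) \<Rightarrow> bool" where
  zero: "total_recursive n (\<lambda>xs. 0)"
| succ: "total_recursive 1 (\<lambda>xs. Suc (hd xs))"
| proj: "i < n \<Longrightarrow> total_recursive n (\<lambda>xs. xs ! i)"
| comp: "\<lbrakk>total_recursive (length gs) f; \<forall>g\<in>set gs. total_recursive n g\<rbrakk>
    \<Longrightarrow> total_recursive n (\<lambda>xs. f (map (\<lambda>g. g xs) gs))"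
| prim_rec: "\<lbrakk>total_recursive n f; total_recursive (Suc (Suc n)) g\<rbrakk>
    \<Longrightarrow> total_recursive (Suc n)
          (\<lambda>xs. rec_nat (f (tl xs)) (\<lambda>m r. g (m # r # tl xs)) (hd xs))"
| minimise: "\<lbrakk>total_recursive (Suc n) f; \<forall>xs. length xs = n \<longrightarrow> (\<exists>m. f (m # xs) = 0)\<rbrakk>
    \<Longrightarrow> total_recursive n (\<lambda>xs. LEAST m. f (m # xs) = 0)"

definition decidable :: "nat set \<Rightarrow> bool" where
  "decidable A \<longleftrightarrow> (\<exists>f. total_recursive 1 f \<and> (\<forall>n. f [n] = of_bool (n \<in> A)))"

section \<open>Decidability on groups\<close>

text \<open>In a word over \<open>gs\<close>, letter \<open>2 * i\<close> stands for \<open>gs ! i\<close> and \<open>2 * i + 1\<close> for its inverse.\<close>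

definition letter_value :: "'a monoid \<Rightarrow> 'a list \<Rightarrow> nat \<Rightarrow> 'a" where
  "letter_value G gs j = (if even j then gs ! (j div 2) else inv\<^bsub>G\<^esub> (gs ! (j div 2)))"

definition word_value :: "'a monoid \<Rightarrow> 'a list \<Rightarrow> nat list \<Rightarrow> 'a" where
  "word_value G gs w = foldr (\<lambda>j x. letter_value G gs j \<otimes>\<^bsub>G\<^esub> x) w \<one>\<^bsub>G\<^esub>"

definition fg_decidable_word_problem :: "'a monoid \<Rightarrow> bool" where
  "fg_decidable_word_problem G \<longleftrightarrow>
     (\<exists>gs. set gs \<subseteq> carrier G \<and> generate G (set gs) = carrier G \<and>
        decidable (list_encode `
          {w. set w \<subseteq> {..<2 * length gs} \<and> word_value G gs w = \<one>\<^bsub>G\<^esub>}))"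

text \<open>
  An encoding assigns to each group element a word over a finite alphabet \<open>{..<k}\<close>. As the set of
  codes is decidable, requiring product and inversion to be restrictions of total recursive
  functions is the same as requiring them to be computable on codes.
\<close>

definition computable_encoding :: "'a monoid \<Rightarrow> ('a \<Rightarrow> nat list) \<Rightarrow> bool" where
  "computable_encoding G enc \<longleftrightarrow>
     inj_on enc (carrier G) \<and>
     (\<exists>k. \<forall>g\<in>carrier G. set (enc g) \<subseteq> {..<k}) \<and>
     decidable (list_encode ` enc ` carrier G) \<and>
     (\<exists>f. total_recursive 2 f \<and>
        (\<forall>g\<in>carrier G. \<forall>h\<in>carrier G.
           f [list_encode (enc g), list_encode (enc h)] = list_encode (enc (g \<otimes>\<^bsub>G\<^esub> h)))) \<and>
     (\<exists>f. total_recursive 1 f \<and>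
        (\<forall>g\<in>carrier G. f [list_encode (enc g)] = list_encode (enc (inv\<^bsub>G\<^esub> g))))"

text \<open>
  A finite set of words is coded by the canonical index \<open>set_encode\<close> of its set of word codes.
  Since encodings of a finitely generated group are unique up to computable bijection, the choice
  of encoding is immaterial; the definition asks for decidability under all of them, and for at
  least one of them to exist.
\<close>

definition decidable_family :: "'a monoid \<Rightarrow> 'a set set \<Rightarrow> bool" where
  "decidable_family G \<C> \<longleftrightarrow>
     fg_decidable_word_problem G \<and>
     (\<exists>enc. computable_encoding G enc) \<and>
     (\<forall>enc. computable_encoding G enc \<longrightarrow>
        decidable ((\<lambda>C. set_encode (list_encode ` enc ` C)) ` \<C>))"

end

theory Submission
  imports Defs
begin

text \<open>
  Let \<open>1 \<rightarrow> K \<rightarrow> G \<rightarrow> \<int> \<rightarrow> 1\<close> be exact with height function \<open>p : G \<rightarrow> \<int>\<close>, and suppose that \<open>K\<close>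
  already has suitable geometries. Given \<open>S\<close>, let \<open>T\<close> consist of those elements of \<open>S\<close> and
  inverses of elements of \<open>S\<close> whose height is positive. Call a finite set \<open>C \<subseteq> G\<close> convex if each
  of its layers, pulled back to \<open>K\<close>, is convex in \<open>K\<close>, and if \<open>c \<otimes> inv h \<in> C\<close> whenever \<open>c \<in> C\<close>,
  \<open>h \<in> T\<close> and \<open>C\<close> has some point lower than \<open>c \<otimes> inv h\<close>.

  The second rule gives midpoints for \<open>h\<close> of nonzero height, because one of \<open>g \<otimes> h\<close>, \<open>g \<otimes> inv h\<close>
  is above \<open>g\<close> and the other one below; midpoints for \<open>h\<close> of height zero come from \<open>K\<close>. What
  makes the rule harmless is that it only carries points downwards and never below the lowest
  layer. Hence hulls are finite: proceed from the top layer to the bottom one and take a hull in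
  \<open>K\<close> at each height (\<open>extend_down\<close>). The same procedure gives anti-exchange, in the equivalent
  form that two points outside a convex set \<open>C\<close> are separated by a larger convex set. If the
  points have different heights, then \<open>C\<close> can be enlarged to contain one of them without gaining
  the other (\<open>separate_heights\<close>). If they are at the same height, a separating set of \<open>K\<close> is put
  in as the layer at this height, the layers above are kept or enlarged, and the layers below
  are completed (\<open>separate_same_height\<close>). Both conditions on \<open>C\<close> are visibly invariant under
  left translations.

  For decidability, group elements are represented by natural numbers such that products are
  computable and it is decidable which numbers represent something. A homomorphism out of a
  finitely generated group is then computable, by searching for a word that represents the
  argument and mapping its letters (\<open>computable_hom\<close>). Applied to the conjugations of \<open>K\<close>, this
  shows that the normal form \<open>t\<^sup>n \<otimes> k\<close> with \<open>k \<in> K\<close> leads from a numbering of \<open>K\<close> to one of \<open>G\<close>;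
  applied to the identity map, it shows that the choice of the numbering, and so of the
  encoding, is immaterial (\<open>decidable_codes_transfer\<close>). Relative to the numbering by normal
  forms the definition of convexity involves only bounded quantifiers over decidable conditions
  (\<open>decidable_layered\<close>).
\<close>

section \<open>Total recursive functions\<close>

text \<open>
  A generator of \<open>total_recursive\<close> is pinned down as a function on all lists, also those of the
  wrong length. Comparing values on lists of length \<open>n\<close> only makes the notion extensional.
\<close>

definition rec_list_fun :: "nat \<Rightarrow> (nat list \<Rightarrow> nat) \<Rightarrow> bool" where
  "rec_list_fun n f \<longleftrightarrow> (\<exists>F. total_recursive n F \<and> (\<forall>xs. length xs = n \<longrightarrow> F xs = f xs))"

lemma rec_list_cong:
  "\<lbrakk>rec_list_fun n f; \<And>xs. length xs = n \<Longrightarrow> f xs = g xs\<rbrakk> \<Longrightarrow> rec_list_fun n g"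
  unfolding rec_list_fun_def by metis

lemma rec_list_proj: "i < n \<Longrightarrow> rec_list_fun n (\<lambda>xs. xs ! i)"
  unfolding rec_list_fun_def using total_recursive.proj by blast

lemma rec_list_comp:
  assumes "rec_list_fun (length gs) f" "\<forall>g\<in>set gs. rec_list_fun n g"
  shows "rec_list_fun n (\<lambda>xs. f (map (\<lambda>g. g xs) gs))"
proof -
  obtain F where F: "total_recursive (length gs) F" "\<And>xs. length xs = length gs \<Longrightarrow> F xs = f xs"
    using assms(1) unfolding rec_list_fun_def by auto
  obtain w where w: "\<forall>g\<in>set gs. total_recursive n (w g) \<and> (\<forall>xs. length xs = n \<longrightarrow> w g xs = g xs)"
    using assms(2) unfolding rec_list_fun_def by metis
  have "total_recursive n (\<lambda>xs. F (map (\<lambda>g. g xs) (map w gs)))"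
    by (rule total_recursive.comp) (use F w in auto)
  moreover have "F (map (\<lambda>g. g xs) (map w gs)) = f (map (\<lambda>g. g xs) gs)" if "length xs = n" for xs
  proof -
    have "map (\<lambda>g. g xs) (map w gs) = map (\<lambda>g. g xs) gs"
      using w that by simp
    then show ?thesis by (simp only:) (simp add: F(2))
  qed
  ultimately show ?thesis
    unfolding rec_list_fun_def by blast
qed

lemma rec_list_comp1:
  assumes "rec_list_fun 1 f" "rec_list_fun n a"
  shows "rec_list_fun n (\<lambda>xs. f [a xs])"
  using rec_list_comp[of "[a]" f n] assms by simp

lemma rec_list_zero: "rec_list_fun n (\<lambda>xs. 0)"
  unfolding rec_list_fun_def using total_recursive.zero by blast

lemma rec_list_Suc:
  assumes "rec_list_fun n a"
  shows "rec_list_fun n (\<lambda>xs. Suc (a xs))"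
proof -
  have "rec_list_fun 1 (\<lambda>xs. Suc (hd xs))"
    unfolding rec_list_fun_def using total_recursive.succ by blast
  from rec_list_comp1[OF this assms] show ?thesis by simp
qed

lemma rec_list_const: "rec_list_fun n (\<lambda>xs. c)"
  by (induction c) (auto intro: rec_list_zero rec_list_Suc)

text \<open>
  Recursion with computed initial value and counter while the arguments \<open>xs\<close> stay in scope: this
  form allows definitions by recursion inside larger expressions.
\<close>

lemma rec_list_rec_nat:
  assumes a: "rec_list_fun n a" and b: "rec_list_fun n b" and g: "rec_list_fun (Suc (Suc n)) g"
  shows "rec_list_fun n (\<lambda>xs. rec_nat (a xs) (\<lambda>m r. g (m # r # xs)) (b xs))"
proof -
  obtain A where A: "total_recursive n A" "\<And>xs. length xs = n \<Longrightarrow> A xs = a xs"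
    using a unfolding rec_list_fun_def by auto
  obtain F where F: "total_recursive (Suc (Suc n)) F"
      "\<And>xs. length xs = Suc (Suc n) \<Longrightarrow> F xs = g xs"
    using g unfolding rec_list_fun_def by auto
  let ?h = "\<lambda>xs. rec_nat (a (tl xs)) (\<lambda>m r. g (m # r # tl xs)) (hd xs)"
  have h: "rec_list_fun (Suc n) ?h"
    unfolding rec_list_fun_def
  proof (intro exI conjI allI impI)
    show "total_recursive (Suc n) (\<lambda>xs. rec_nat (A (tl xs)) (\<lambda>m r. F (m # r # tl xs)) (hd xs))"
      by (rule total_recursive.prim_rec[OF A(1) F(1)])
  qed (use A(2) F(2) in simp)
  let ?gs = "b # map (\<lambda>i xs. xs ! i) [0..<n]"
  have "rec_list_fun n (\<lambda>xs. ?h (map (\<lambda>g. g xs) ?gs))"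
    by (rule rec_list_comp) (use h b in \<open>auto intro: rec_list_proj\<close>)
  then show ?thesis
  proof (rule rec_list_cong)
    fix xs :: "nat list"
    assume "length xs = n"
    then have "map (\<lambda>g. g xs) (map (\<lambda>i xs. xs ! i) [0..<n]) = xs"
      using map_nth[of xs] by (simp add: comp_def)
    then show "?h (map (\<lambda>g. g xs) ?gs) = rec_nat (a xs) (\<lambda>m r. g (m # r # xs)) (b xs)"
      by simp
  qed
qed

lemma rec_list_Least:
  assumes g: "rec_list_fun (Suc n) g" and ex: "\<And>xs. length xs = n \<Longrightarrow> \<exists>m. g (m # xs) = 0"
  shows "rec_list_fun n (\<lambda>xs. LEAST m. g (m # xs) = 0)"
proof -
  obtain F where F: "total_recursive (Suc n) F" "\<And>xs. length xs = Suc n \<Longrightarrow> F xs = g xs"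
    using g unfolding rec_list_fun_def by auto
  have "total_recursive n (\<lambda>xs. LEAST m. F (m # xs) = 0)"
    by (rule total_recursive.minimise[OF F(1)]) (use F(2) ex in simp)
  then show ?thesis
    unfolding rec_list_fun_def using F(2) by (intro exI[of _ "\<lambda>xs. LEAST m. F (m # xs) = 0"]) simp
qed

lemma rec_list_add:
  assumes "rec_list_fun n a" "rec_list_fun n b"
  shows "rec_list_fun n (\<lambda>xs. a xs + b xs)"
proof -
  have "rec_list_fun n (\<lambda>xs. rec_nat (a xs) (\<lambda>m r. Suc ((m # r # xs) ! 1)) (b xs))"
    by (intro rec_list_rec_nat assms rec_list_Suc rec_list_proj) simp
  moreover have "rec_nat x (\<lambda>m r. Suc r) y = x + y" for x y :: nat
    by (induction y) auto
  ultimately show ?thesis by simp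
qed

lemma rec_list_pred:
  assumes "rec_list_fun n a"
  shows "rec_list_fun n (\<lambda>xs. a xs - 1)"
proof -
  have "rec_list_fun n (\<lambda>xs. rec_nat 0 (\<lambda>m r. (m # r # xs) ! 0) (a xs))"
    by (intro rec_list_rec_nat assms rec_list_zero rec_list_proj) simp
  moreover have "rec_nat 0 (\<lambda>m r. m) x = x - 1" for x :: nat
    by (cases x) auto
  ultimately show ?thesis by simp
qed

lemma rec_list_diff:
  assumes "rec_list_fun n a" "rec_list_fun n b"
  shows "rec_list_fun n (\<lambda>xs. a xs - b xs)"
proof -
  have "rec_list_fun n (\<lambda>xs. rec_nat (a xs) (\<lambda>m r. (m # r # xs) ! 1 - 1) (b xs))"
    by (intro rec_list_rec_nat assms rec_list_pred rec_list_proj) simp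
  moreover have "rec_nat x (\<lambda>m r. r - 1) y = x - y" for x y :: nat
    by (induction y) auto
  ultimately show ?thesis by simp
qed

lemma rec_list_triangle:
  assumes "rec_list_fun n a"
  shows "rec_list_fun n (\<lambda>xs. triangle (a xs))"
proof -
  have "rec_list_fun n (\<lambda>xs. rec_nat 0 (\<lambda>m r. (m # r # xs) ! 1 + Suc ((m # r # xs) ! 0)) (a xs))"
    by (intro rec_list_rec_nat assms rec_list_add rec_list_zero rec_list_Suc rec_list_proj) simp_all
  moreover have "rec_nat 0 (\<lambda>m r. r + Suc m) x = triangle x" for x :: nat
    by (induction x) auto
  ultimately show ?thesis by simp
qed

text \<open>
  With pairs coded as numbers, functions of one argument suffice from here on, and a bound
  variable in an expression is treated by pairing it with the argument.
\<close>

definition cpair :: "nat \<Rightarrow> nat \<Rightarrow> nat" where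
  "cpair x y = prod_encode (x, y)"

definition cfst :: "nat \<Rightarrow> nat" where
  "cfst z = fst (prod_decode z)"

definition csnd :: "nat \<Rightarrow> nat" where
  "csnd z = snd (prod_decode z)"

lemma cfst_cpair [simp]: "cfst (cpair x y) = x"
  and csnd_cpair [simp]: "csnd (cpair x y) = y"
  and cpair_cfst_csnd [simp]: "cpair (cfst z) (csnd z) = z"
  by (simp_all add: cpair_def cfst_def csnd_def)

lemma cpair_eq_iff [simp]: "cpair x y = cpair x' y' \<longleftrightarrow> x = x' \<and> y = y'"
  by (simp add: cpair_def)

lemma le_cpair: "x \<le> cpair x y" "y \<le> cpair x y"
  by (simp_all add: cpair_def le_prod_encode_1 le_prod_encode_2)

text \<open>
  The number of the diagonal on which a pair lies in Cantor's enumeration. It is the one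
  quantity whose computation needs a search; both components of the pair are obtained from it by
  arithmetic.
\<close>

definition diagonal :: "nat \<Rightarrow> nat" where
  "diagonal z = (LEAST k. Suc z - triangle (Suc k) = 0)"

lemma diagonal_eq: "diagonal z = cfst z + csnd z"
proof -
  define x y where "x = cfst z" and "y = csnd z"
  have z: "z = triangle (x + y) + x"
    using cpair_cfst_csnd[of z] by (simp add: cpair_def prod_encode_def x_def y_def)
  have mono: "triangle i \<le> triangle j" if "i \<le> j" for i j
    using that by (induction j rule: dec_induct) auto
  show ?thesis
    unfolding diagonal_def x_def[symmetric] y_def[symmetric]
  proof (rule Least_equality)
    show "Suc z - triangle (Suc (x + y)) = 0" using z by simp
  next
    fix k assume "Suc z - triangle (Suc k) = 0"
    then have "triangle (x + y) < triangle (Suc k)" using z by simp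
    then have "x + y < Suc k" using mono[of "Suc k" "x + y"] by linarith
    then show "x + y \<le> k" by simp
  qed
qed

lemma cfst_diagonal: "cfst z = z - triangle (diagonal z)"
  using cpair_cfst_csnd[of z] unfolding diagonal_eq cpair_def prod_encode_def by simp

lemma csnd_diagonal: "csnd z = diagonal z - cfst z"
  by (simp add: diagonal_eq)

lemma rec_list_cpair:
  assumes "rec_list_fun n a" "rec_list_fun n b"
  shows "rec_list_fun n (\<lambda>xs. cpair (a xs) (b xs))"
  unfolding cpair_def prod_encode_def
  by (simp add: rec_list_add rec_list_triangle assms)

lemma rec_list_diagonal: "rec_list_fun 1 (\<lambda>xs. diagonal (xs ! 0))"
proof -
  have "rec_list_fun 1 (\<lambda>xs. LEAST k. Suc ((k # xs) ! 1) - triangle (Suc ((k # xs) ! 0)) = 0)"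
  proof (rule rec_list_Least)
    show "rec_list_fun (Suc 1) (\<lambda>ys. Suc (ys ! 1) - triangle (Suc (ys ! 0)))"
      by (intro rec_list_diff rec_list_Suc rec_list_triangle rec_list_proj) simp_all
    have "Suc z \<le> triangle (Suc z)" for z by (induction z) auto
    then show "\<exists>m. Suc ((m # xs) ! 1) - triangle (Suc ((m # xs) ! 0)) = 0" for xs
      by (metis diff_is_0_eq nth_Cons_0 nth_Cons_Suc One_nat_def)
  qed
  then show ?thesis by (simp add: diagonal_def)
qed

definition computable :: "(nat \<Rightarrow> nat) \<Rightarrow> bool" where
  "computable f \<longleftrightarrow> rec_list_fun 1 (\<lambda>xs. f (xs ! 0))"

lemma computable_iff: "computable f \<longleftrightarrow> (\<exists>F. total_recursive 1 F \<and> (\<forall>n. F [n] = f n))"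
proof
  assume "computable f"
  then obtain F where "total_recursive 1 F" "\<And>xs. length xs = 1 \<Longrightarrow> F xs = f (xs ! 0)"
    unfolding computable_def rec_list_fun_def by auto
  then show "\<exists>F. total_recursive 1 F \<and> (\<forall>n. F [n] = f n)" by force
next
  assume "\<exists>F. total_recursive 1 F \<and> (\<forall>n. F [n] = f n)"
  then obtain F where F: "total_recursive 1 F" "\<And>n. F [n] = f n" by blast
  have "F xs = f (xs ! 0)" if "length xs = 1" for xs
    using that F(2) by (cases xs) auto
  then show "computable f"
    unfolding computable_def rec_list_fun_def using F(1) by blast
qed

lemma rec_list_computable:
  assumes "computable f" "rec_list_fun n a"
  shows "rec_list_fun n (\<lambda>xs. f (a xs))"
  using rec_list_comp1[OF assms(1)[unfolded computable_def] assms(2)] by simp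

lemma computable_id: "computable (\<lambda>x. x)"
  and computable_const: "computable (\<lambda>x. c)"
  unfolding computable_def by (simp_all add: rec_list_proj rec_list_const)

lemma computable_comp: "\<lbrakk>computable f; computable a\<rbrakk> \<Longrightarrow> computable (\<lambda>x. f (a x))"
  unfolding computable_def[of a] computable_def[of "\<lambda>x. f (a x)"] by (rule rec_list_computable)

lemma computable_cpair: "\<lbrakk>computable a; computable b\<rbrakk> \<Longrightarrow> computable (\<lambda>x. cpair (a x) (b x))"
  unfolding computable_def by (rule rec_list_cpair)

lemma computable_Suc: "computable a \<Longrightarrow> computable (\<lambda>x. Suc (a x))"
  unfolding computable_def by (rule rec_list_Suc)

lemma computable_add: "\<lbrakk>computable a; computable b\<rbrakk> \<Longrightarrow> computable (\<lambda>x. a x + b x)"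
  unfolding computable_def by (rule rec_list_add)

lemma computable_diff: "\<lbrakk>computable a; computable b\<rbrakk> \<Longrightarrow> computable (\<lambda>x. a x - b x)"
  unfolding computable_def by (rule rec_list_diff)

lemma computable_diagonal: "computable diagonal"
  unfolding computable_def by (rule rec_list_diagonal)

lemma computable_cfst: "computable a \<Longrightarrow> computable (\<lambda>x. cfst (a x))"
  unfolding computable_def cfst_diagonal
  by (intro rec_list_diff rec_list_triangle rec_list_computable[OF computable_diagonal])

lemma computable_csnd: "computable a \<Longrightarrow> computable (\<lambda>x. csnd (a x))"
  unfolding csnd_diagonal
  by (intro computable_diff computable_cfst computable_comp[OF computable_diagonal])

lemma computable_rec_nat:
  assumes "computable (\<lambda>p. g (cfst p) (cfst (csnd p)) (csnd (csnd p)))" "computable a" "computable b"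
  shows "computable (\<lambda>x. rec_nat (a x) (\<lambda>m r. g x m r) (b x))"
proof -
  let ?g = "\<lambda>p. g (cfst p) (cfst (csnd p)) (csnd (csnd p))"
  have "rec_list_fun 1 (\<lambda>xs. rec_nat (a (xs ! 0))
      (\<lambda>m r. ?g (cpair ((m # r # xs) ! 2) (cpair ((m # r # xs) ! 0) ((m # r # xs) ! 1)))) (b (xs ! 0)))"
    using assms(2,3) unfolding computable_def
    by (intro rec_list_rec_nat rec_list_computable[OF assms(1)] rec_list_cpair rec_list_proj) simp_all
  then show ?thesis unfolding computable_def by simp
qed

lemma computable_Least:
  assumes g: "computable (\<lambda>p. g (cfst p) (csnd p))" and ex: "\<And>x. \<exists>m. g x m = 0"
  shows "computable (\<lambda>x. LEAST m. g x m = 0)"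
proof -
  let ?g = "\<lambda>p. g (cfst p) (csnd p)"
  have "rec_list_fun 1 (\<lambda>xs. LEAST m. ?g (cpair ((m # xs) ! 1) ((m # xs) ! 0)) = 0)"
  proof (rule rec_list_Least)
    show "rec_list_fun (Suc 1) (\<lambda>ys. ?g (cpair (ys ! 1) (ys ! 0)))"
      by (intro rec_list_computable[OF g] rec_list_cpair rec_list_proj) simp_all
  qed (use ex in simp)
  then show ?thesis unfolding computable_def by simp
qed

lemma computable_binary:
  "(\<exists>F. total_recursive 2 F \<and> (\<forall>x y. F [x, y] = f x y)) \<longleftrightarrow> computable (\<lambda>p. f (cfst p) (csnd p))"
proof
  assume "\<exists>F. total_recursive 2 F \<and> (\<forall>x y. F [x, y] = f x y)"
  then obtain F where F: "total_recursive 2 F" "\<And>x y. F [x, y] = f x y" by blast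
  have "rec_list_fun (length [\<lambda>xs. cfst (xs ! 0), \<lambda>xs. csnd (xs ! 0)]) F"
    using F(1) unfolding rec_list_fun_def by (auto simp: numeral_2_eq_2)
  from rec_list_comp[OF this, of 1] show "computable (\<lambda>p. f (cfst p) (csnd p))"
    using computable_cfst[OF computable_id] computable_csnd[OF computable_id]
    unfolding computable_def by (simp add: F(2))
next
  assume "computable (\<lambda>p. f (cfst p) (csnd p))"
  from rec_list_computable[OF this, of 2 "\<lambda>xs. cpair (xs ! 0) (xs ! 1)"]
  have "rec_list_fun 2 (\<lambda>xs. f (xs ! 0) (xs ! 1))"
    by (simp add: rec_list_cpair rec_list_proj)
  then obtain F where "total_recursive 2 F" "\<And>xs. length xs = 2 \<Longrightarrow> F xs = f (xs ! 0) (xs ! 1)"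
    unfolding rec_list_fun_def by blast
  then show "\<exists>F. total_recursive 2 F \<and> (\<forall>x y. F [x, y] = f x y)"
    by (intro exI[of _ F]) simp
qed

section \<open>Decidable predicates\<close>

lemmas computable_basic =
  computable_id computable_const computable_Suc computable_add computable_diff
  computable_cpair computable_cfst computable_csnd

definition decidable_pred :: "(nat \<Rightarrow> bool) \<Rightarrow> bool" where
  "decidable_pred P \<longleftrightarrow> computable (\<lambda>x. of_bool (P x))"

lemma decidable_iff: "decidable A \<longleftrightarrow> decidable_pred (\<lambda>x. x \<in> A)"
  by (simp add: decidable_def decidable_pred_def computable_iff)

lemma decidable_pred_comp: "\<lbrakk>decidable_pred P; computable a\<rbrakk> \<Longrightarrow> decidable_pred (\<lambda>x. P (a x))"
  unfolding decidable_pred_def by (rule computable_comp)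

lemma decidable_pred_const: "decidable_pred (\<lambda>x. c)"
  by (simp add: decidable_pred_def computable_const)

lemma decidable_pred_not:
  assumes "decidable_pred P" shows "decidable_pred (\<lambda>x. \<not> P x)"
proof -
  have "computable (\<lambda>x. 1 - of_bool (P x))"
    using assms unfolding decidable_pred_def by (intro computable_basic)
  moreover have "of_bool (\<not> p) = (1::nat) - of_bool p" for p
    by (cases p) auto
  ultimately show ?thesis by (simp only: decidable_pred_def)
qed

lemma decidable_pred_conj:
  assumes "decidable_pred P" "decidable_pred Q" shows "decidable_pred (\<lambda>x. P x \<and> Q x)"
proof -
  have "computable (\<lambda>x. of_bool (P x) - (1 - of_bool (Q x)))"
    using assms unfolding decidable_pred_def by (intro computable_basic)
  moreover have "of_bool (p \<and> q) = of_bool p - ((1::nat) - of_bool q)" for p q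
    by (cases p; cases q) auto
  ultimately show ?thesis by (simp add: decidable_pred_def)
qed

lemma decidable_pred_imp:
  assumes "decidable_pred P" "decidable_pred Q" shows "decidable_pred (\<lambda>x. P x \<longrightarrow> Q x)"
proof -
  have "(\<lambda>x. P x \<longrightarrow> Q x) = (\<lambda>x. \<not> (P x \<and> \<not> Q x))" by auto
  with assms show ?thesis by (simp only: decidable_pred_not decidable_pred_conj)
qed

lemma decidable_pred_le:
  assumes "computable a" "computable b" shows "decidable_pred (\<lambda>x. a x \<le> b x)"
proof -
  have "computable (\<lambda>x. 1 - (a x - b x))"
    using assms by (intro computable_basic)
  moreover have "of_bool (i \<le> j) = 1 - (i - j)" for i j :: nat
    by auto
  ultimately show ?thesis by (simp add: decidable_pred_def)
qed

lemma decidable_pred_less: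
  "\<lbrakk>computable a; computable b\<rbrakk> \<Longrightarrow> decidable_pred (\<lambda>x. a x < b x)"
  using decidable_pred_le[of "\<lambda>x. Suc (a x)" b] by (simp add: computable_Suc Suc_le_eq)

lemma decidable_pred_eq:
  assumes "computable a" "computable b" shows "decidable_pred (\<lambda>x. a x = b x)"
  unfolding order_eq_iff using assms by (intro decidable_pred_conj decidable_pred_le)

lemma decidable_pred_mem:
  "\<lbrakk>decidable A; computable a\<rbrakk> \<Longrightarrow> decidable_pred (\<lambda>x. a x \<in> A)"
  using decidable_pred_comp by (simp add: decidable_iff)

lemma decidable_pred_ball_finite:
  assumes "finite A" "\<And>h. h \<in> A \<Longrightarrow> decidable_pred (\<lambda>x. P h x)"
  shows "decidable_pred (\<lambda>x. \<forall>h\<in>A. P h x)"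
  using assms by (induction A) (auto intro: decidable_pred_const decidable_pred_conj)

lemma computable_if:
  assumes "decidable_pred P" "computable a" "computable b"
  shows "computable (\<lambda>x. if P x then a x else b x)"
proof -
  have "computable (\<lambda>x. rec_nat (b x) (\<lambda>m r. a x) (of_bool (P x)))"
    using assms unfolding decidable_pred_def
    by (intro computable_rec_nat computable_comp[OF assms(2)] computable_basic)
  moreover have "rec_nat v (\<lambda>m r. u) (of_bool p) = (if p then u else v)" for u v :: nat and p
    by (cases p) auto
  ultimately show ?thesis by simp
qed

text \<open>
  The premise has the expression \<open>P x i\<close> with \<open>x\<close> and \<open>i\<close> replaced by the components of a pair,
  so that it is again about a predicate of one argument. All rules for bound variables have this
  form.
\<close>

lemma decidable_pred_all_less:
  assumes "decidable_pred (\<lambda>p. P (cfst p) (csnd p))" "computable b"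
  shows "decidable_pred (\<lambda>x. \<forall>i<b x. P x i)"
proof -
  have "computable (\<lambda>x. rec_nat 1 (\<lambda>m r. if P x m then r else 0) (b x))"
    using decidable_pred_comp[OF assms(1), of "\<lambda>p. cpair (cfst p) (cfst (csnd p))"]
    by (intro computable_rec_nat computable_if computable_basic assms(2))
       (simp add: computable_basic)
  moreover have "rec_nat (1::nat) (\<lambda>m r. if Q m then r else 0) n = of_bool (\<forall>i<n. Q i)" for Q and n :: nat
    by (induction n) (auto simp: less_Suc_eq)
  ultimately show ?thesis by (simp only: decidable_pred_def)
qed

lemma computable_sum_less:
  assumes "computable (\<lambda>p. f (cfst p) (csnd p))" "computable b"
  shows "computable (\<lambda>x. \<Sum>i<b x. f x i)"
proof -
  have "computable (\<lambda>x. rec_nat 0 (\<lambda>m r. r + f x m) (b x))"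
    using computable_comp[OF assms(1), of "\<lambda>p. cpair (cfst p) (cfst (csnd p))"]
    by (intro computable_rec_nat computable_basic assms(2)) (simp add: computable_basic)
  moreover have "rec_nat 0 (\<lambda>m r. r + g m) n = (\<Sum>i<n. g i)" for g :: "nat \<Rightarrow> nat" and n
    by (induction n) auto
  ultimately show ?thesis by simp
qed

lemma computable_Least_pred:
  assumes "decidable_pred (\<lambda>p. P (cfst p) (csnd p))" "\<And>x. \<exists>m. P x m"
  shows "computable (\<lambda>x. LEAST m. P x m)"
proof -
  have "computable (\<lambda>x. LEAST m. of_bool (\<not> P x m) = (0::nat))"
    using decidable_pred_not[OF assms(1)] assms(2)
    by (intro computable_Least) (auto simp: decidable_pred_def)
  then show ?thesis by simp
qed

section \<open>Computing with coded integers, finite sets and lists\<close>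

lemma computable_power2: "computable a \<Longrightarrow> computable (\<lambda>x. 2 ^ a x)"
proof -
  assume "computable a"
  then have "computable (\<lambda>x. rec_nat 1 (\<lambda>m r. r + r) (a x))"
    by (intro computable_rec_nat computable_basic)
  moreover have "rec_nat 1 (\<lambda>m r. r + r) n = (2::nat) ^ n" for n
    by (induction n) auto
  ultimately show ?thesis by simp
qed

lemma computable_half: "computable a \<Longrightarrow> computable (\<lambda>x. a x div 2)"
proof -
  assume a: "computable a"
  have "computable (\<lambda>x. LEAST q. x < q + q + 2)"
  proof (intro computable_Least_pred decidable_pred_less computable_basic)
    show "\<exists>q. x < q + q + 2" for x :: nat by (rule exI[of _ x]) simp
  qed
  moreover have "(LEAST q. x < q + q + 2) = x div 2" for x :: nat
    by (rule Least_equality) auto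
  ultimately have "computable (\<lambda>x. x div 2)" by simp
  from computable_comp[OF this a] show ?thesis .
qed

lemma decidable_pred_even: "computable a \<Longrightarrow> decidable_pred (\<lambda>x. even (a x))"
proof -
  assume "computable a"
  then have "decidable_pred (\<lambda>x. a x div 2 + a x div 2 = a x)"
    by (intro decidable_pred_eq computable_add computable_half)
  moreover have "n div 2 + n div 2 = n \<longleftrightarrow> even n" for n :: nat by presburger
  ultimately show ?thesis by simp
qed

lemma decidable_pred_mem_set_decode:
  assumes "computable a" "computable b"
  shows "decidable_pred (\<lambda>x. a x \<in> set_decode (b x))"
proof -
  have "computable (\<lambda>x. rec_nat (b x) (\<lambda>m r. r div 2) (a x))"
    using assms by (intro computable_rec_nat computable_half computable_basic)
  moreover have "rec_nat D (\<lambda>m r. r div 2) n = D div 2 ^ n" for D n :: nat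
    by (induction n) (simp_all add: div_mult2_eq power_Suc2 del: power_Suc)
  ultimately have "decidable_pred (\<lambda>x. \<not> even (b x div 2 ^ a x))"
    by (intro decidable_pred_not decidable_pred_even) simp
  then show ?thesis by (simp add: set_decode_def)
qed

lemmas decidable_pred_basic =
  decidable_pred_const decidable_pred_not decidable_pred_conj decidable_pred_imp
  decidable_pred_le decidable_pred_less decidable_pred_eq
  decidable_pred_even decidable_pred_mem_set_decode decidable_pred_all_less
  computable_basic computable_power2 computable_half computable_if

text \<open>
  An element of a coded set is smaller than the code. This is why quantifiers over the members
  of a coded set are bounded.
\<close>

lemma set_decode_less: "i \<in> set_decode D \<Longrightarrow> i < D"
proof -
  assume "i \<in> set_decode D"
  then have "{i} \<subseteq> set_decode D" by simp
  then have "set_encode {i} \<le> D"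
    by (intro subset_decode_imp_le) (simp only: set_encode_inverse finite.intros)
  then have "2 ^ i \<le> D" by (simp add: set_encode_def)
  moreover have "i < 2 ^ i" by (rule less_exp)
  ultimately show ?thesis by linarith
qed

lemma decidable_pred_ball_set_decode:
  assumes "decidable_pred (\<lambda>p. P (cfst p) (csnd p))" "computable b"
  shows "decidable_pred (\<lambda>x. \<forall>i\<in>set_decode (b x). P x i)"
proof -
  have "decidable_pred (\<lambda>x. \<forall>i<b x. i \<in> set_decode (b x) \<longrightarrow> P x i)"
    using computable_comp[OF assms(2)]
    by (intro decidable_pred_basic assms) (simp add: computable_basic)
  moreover have "(\<forall>i<D. i \<in> set_decode D \<longrightarrow> Q i) \<longleftrightarrow> (\<forall>i\<in>set_decode D. Q i)" for D Q
    using set_decode_less by blast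
  ultimately show ?thesis by simp
qed

lemma computable_sum_filter:
  assumes "computable (\<lambda>p. f (cfst p) (csnd p))" "computable b"
    and "decidable_pred (\<lambda>p. P (cfst p) (csnd p))"
  shows "computable (\<lambda>x. \<Sum>i | i < b x \<and> P x i. f x i)"
proof -
  have "computable (\<lambda>x. \<Sum>i<b x. if P x i then f x i else 0)"
    by (intro computable_sum_less decidable_pred_basic assms)
  moreover have "(\<Sum>i<n. if Q i then g i else 0) = (\<Sum>i | i < n \<and> Q i. g i)"
    for n Q and g :: "nat \<Rightarrow> nat"
    by (simp add: sum.If_cases lessThan_def Collect_conj_eq)
  ultimately show ?thesis by simp
qed

text \<open>
  Addition and comparison of coded integers are reduced to natural numbers: \<open>int_code u v\<close> is
  the code of \<open>u - v\<close>, and \<open>code_pos\<close>, \<open>code_neg\<close> are the positive and negative parts of a coded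
  integer.
\<close>

definition int_code :: "nat \<Rightarrow> nat \<Rightarrow> nat" where
  "int_code u v = (if v \<le> u then (u - v) + (u - v) else Suc ((v - Suc u) + (v - Suc u)))"

definition code_pos :: "nat \<Rightarrow> nat" where
  "code_pos a = (if even a then a div 2 else 0)"

definition code_neg :: "nat \<Rightarrow> nat" where
  "code_neg a = (if even a then 0 else Suc (a div 2))"

lemma int_code_eq: "int_code u v = int_encode (int u - int v)"
  by (auto simp: int_code_def int_encode_def sum_encode_def nat_diff_distrib)

lemma code_pos_neg:
  "code_pos (int_encode z) = nat z" "code_neg (int_encode z) = nat (- z)"
  by (auto simp: code_pos_def code_neg_def int_encode_def sum_encode_def)

lemma computable_int_code: "\<lbrakk>computable a; computable b\<rbrakk> \<Longrightarrow> computable (\<lambda>x. int_code (a x) (b x))"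
  and computable_code_pos: "computable a \<Longrightarrow> computable (\<lambda>x. code_pos (a x))"
  and computable_code_neg: "computable a \<Longrightarrow> computable (\<lambda>x. code_neg (a x))"
  unfolding int_code_def code_pos_def code_neg_def by (intro decidable_pred_basic; assumption)+

text \<open>
  A coded list is read from the front by iterating one step as often as its code says, which is
  at least as often as the list is long; once the list is exhausted the step changes nothing.
\<close>

lemma computable_foldl_list_decode:
  assumes g: "computable (\<lambda>p. g (cfst p) (csnd p))" and "computable a" "computable b"
  shows "computable (\<lambda>x. foldl g (a x) (list_decode (b x)))"
proof -
  \<comment> \<open>the state is the pair of the code of the unread part and the value so far\<close>
  define step where "step s = (if cfst s = 0 then s
      else cpair (csnd (cfst s - 1)) (g (csnd s) (cfst (cfst s - 1))))" for s
  have step: "computable step"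
    unfolding step_def
    using computable_comp[OF g, of "\<lambda>s. cpair (csnd s) (cfst (cfst s - 1))"]
    by (intro decidable_pred_basic) (simp add: computable_basic)
  have "computable (\<lambda>x. csnd (rec_nat (cpair (b x) (a x)) (\<lambda>m r. step r) (b x)))"
    by (intro computable_rec_nat computable_comp[OF step] computable_basic assms)
  moreover have "csnd (rec_nat (cpair (list_encode w) e) (\<lambda>m r. step r) n) = foldl g e w"
    if "length w \<le> n" for w e n
    using that
  proof (induction n arbitrary: w e)
    case (Suc n)
    have shift: "rec_nat s (\<lambda>m r. step r) (Suc k) = rec_nat (step s) (\<lambda>m r. step r) k" for s k
      by (induction k) auto
    show ?case
    proof (cases w)
      case Nil
      have "step (cpair 0 e) = cpair 0 e" by (simp add: step_def)
      then show ?thesis using Suc.IH[of "[]" e] Nil unfolding shift by simp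
    next
      case (Cons j w')
      then have "step (cpair (list_encode w) e) = cpair (list_encode w') (g e j)"
        by (simp add: step_def flip: cpair_def)
      then show ?thesis using Suc Cons unfolding shift by simp
    qed
  qed simp
  moreover have "length w \<le> list_encode w" for w
  proof (induction w)
    case (Cons j w)
    then show ?case using le_prod_encode_2[of "list_encode w" j] by simp
  qed simp
  ultimately have "computable (\<lambda>x. csnd (rec_nat (cpair (b x) (a x)) (\<lambda>m r. step r) (b x)))"
    and "csnd (rec_nat (cpair (list_encode (list_decode y)) e) (\<lambda>m r. step r)
        (list_encode (list_decode y))) = foldl g e (list_decode y)" for y e
    by blast+
  then show ?thesis by simp
qed

lemma computable_table: "computable (\<lambda>j. if j < length xs then xs ! j else d)"
proof (induction xs rule: rev_induct)
  case (snoc y xs)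
  have "computable (\<lambda>j. if j = length xs then y else if j < length xs then xs ! j else d)"
    by (intro computable_if decidable_pred_basic snoc)
  moreover have "(\<lambda>j. if j = length xs then y else if j < length xs then xs ! j else d) =
      (\<lambda>j. if j < length (xs @ [y]) then (xs @ [y]) ! j else d)"
    by (auto simp: nth_append less_Suc_eq)
  ultimately show ?case by simp
qed (simp add: computable_const)

section \<open>Numbered groups\<close>

text \<open>
  Numbers take the place of words as codes. Only products are asked to be computable: inverses
  are then found by search.
\<close>

definition numbering :: "'a monoid \<Rightarrow> ('a \<Rightarrow> nat) \<Rightarrow> bool" where
  "numbering G \<nu> \<longleftrightarrow> inj_on \<nu> (carrier G) \<and> decidable (\<nu> ` carrier G) \<and>
     (\<exists>f. computable f \<and>
        (\<forall>g\<in>carrier G. \<forall>h\<in>carrier G. f (cpair (\<nu> g) (\<nu> h)) = \<nu> (g \<otimes>\<^bsub>G\<^esub> h)))"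

text \<open>
  Every list of numbers is a word: letters out of range stand for the unit. A search through all
  words then needs no check that a word is well formed.
\<close>

definition letter_at :: "'a monoid \<Rightarrow> 'a list \<Rightarrow> nat \<Rightarrow> 'a" where
  "letter_at G xs j = (if j < length xs then xs ! j else \<one>\<^bsub>G\<^esub>)"

definition word_prod :: "'a monoid \<Rightarrow> 'a list \<Rightarrow> nat list \<Rightarrow> 'a" where
  "word_prod G xs w = foldl (\<lambda>x j. x \<otimes>\<^bsub>G\<^esub> letter_at G xs j) \<one>\<^bsub>G\<^esub> w"

text \<open>
  Generation as a monoid; the list has to contain inverses explicitly.
\<close>

definition spanning :: "'a monoid \<Rightarrow> 'a list \<Rightarrow> bool" where
  "spanning G xs \<longleftrightarrow> set xs \<subseteq> carrier G \<and> (\<forall>g\<in>carrier G. \<exists>w. word_prod G xs w = g)"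

lemma word_prod_Nil [simp]: "word_prod G xs [] = \<one>\<^bsub>G\<^esub>"
  and word_prod_snoc [simp]:
    "word_prod G xs (w @ [j]) = word_prod G xs w \<otimes>\<^bsub>G\<^esub> letter_at G xs j"
  by (simp_all add: word_prod_def)

text \<open>
  Codes of finite sets are faithful, so deciding the set of codes decides the family itself.
\<close>

lemma code_mem_iff:
  assumes inj: "inj_on \<nu> X" and sub: "\<C> \<subseteq> Fpow X" and B: "B \<in> Fpow X"
  shows "set_encode (\<nu> ` B) \<in> (\<lambda>C. set_encode (\<nu> ` C)) ` \<C> \<longleftrightarrow> B \<in> \<C>"
proof -
  have "B = C" if "C \<in> \<C>" "set_encode (\<nu> ` B) = set_encode (\<nu> ` C)" for C
  proof -
    have C: "finite C" "C \<subseteq> X" using that(1) sub by (auto simp: Fpow_def)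
    then have "\<nu> ` B = \<nu> ` C" using that(2) B by (simp add: set_encode_eq Fpow_def)
    then show ?thesis using inj B C(2) by (simp add: inj_on_image_eq_iff Fpow_def)
  qed
  then show ?thesis by blast
qed

text \<open>
  The decidability notions are about group records without further fields.
\<close>

locale plain_group = group G for G :: "'a monoid" (structure)

lemma plain_group_iff: "plain_group G \<longleftrightarrow> group G"
  by (simp add: plain_group_def)

context plain_group
begin

lemma letter_at_closed: "set xs \<subseteq> carrier G \<Longrightarrow> letter_at G xs j \<in> carrier G"
  using nth_mem by (fastforce simp: letter_at_def)

lemma word_prod_closed: "set xs \<subseteq> carrier G \<Longrightarrow> word_prod G xs w \<in> carrier G"
  by (induction w rule: rev_induct) (auto simp: letter_at_closed)

lemma word_prod_append:
  assumes "set xs \<subseteq> carrier G"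
  shows "word_prod G xs (u @ w) = word_prod G xs u \<otimes> word_prod G xs w"
  using assms
proof (induction w rule: rev_induct)
  case (snoc j w)
  then show ?case
    by (simp add: word_prod_closed letter_at_closed m_assoc flip: append_assoc)
qed (simp add: word_prod_closed)

lemma word_prod_single: "set xs \<subseteq> carrier G \<Longrightarrow> word_prod G xs [j] = letter_at G xs j"
  using word_prod_snoc[of G xs "[]" j] by (simp add: letter_at_closed)

lemma word_prod_Cons:
  "set xs \<subseteq> carrier G \<Longrightarrow> word_prod G xs (j # w) = letter_at G xs j \<otimes> word_prod G xs w"
  using word_prod_append[of xs "[j]" w] by (simp add: word_prod_single)

lemma hom_word_prod:
  assumes "group H" "\<phi> \<in> hom G H" "set xs \<subseteq> carrier G"
  shows "\<phi> (word_prod G xs w) = word_prod H (map \<phi> xs) w"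
proof -
  have "\<phi> \<one> = \<one>\<^bsub>H\<^esub>" using assms(1,2) hom_one is_group by blast
  then have "\<phi> (letter_at G xs j) = letter_at H (map \<phi> xs) j" for j
    by (simp add: letter_at_def)
  then show ?thesis
    using \<open>\<phi> \<one> = \<one>\<^bsub>H\<^esub>\<close>
    by (induction w rule: rev_induct)
       (simp_all add: hom_mult[OF assms(2)] word_prod_closed letter_at_closed assms(3))
qed

lemma computable_word_prod:
  assumes \<nu>: "numbering G \<nu>" and xs: "set xs \<subseteq> carrier G"
  shows "computable (\<lambda>c. \<nu> (word_prod G xs (list_decode c)))"
proof -
  obtain f where f: "computable f"
      "\<And>g h. g \<in> carrier G \<Longrightarrow> h \<in> carrier G \<Longrightarrow> f (cpair (\<nu> g) (\<nu> h)) = \<nu> (g \<otimes> h)"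
    using \<nu> unfolding numbering_def by blast
  define t where "t j = (if j < length (map \<nu> xs) then map \<nu> xs ! j else \<nu> \<one>)" for j
  have t: "computable t" unfolding t_def by (rule computable_table)
  have t_eq: "t j = \<nu> (letter_at G xs j)" for j
    by (simp add: t_def letter_at_def)
  have "computable (\<lambda>c. foldl (\<lambda>a j. f (cpair a (t j))) (\<nu> \<one>) (list_decode c))"
    by (intro computable_foldl_list_decode computable_comp[OF f(1)] computable_comp[OF t]
        computable_basic)
  moreover have "foldl (\<lambda>a j. f (cpair a (t j))) (\<nu> \<one>) w = \<nu> (word_prod G xs w)" for w
    by (induction w rule: rev_induct)
       (simp_all add: f(2) t_eq word_prod_closed letter_at_closed xs)
  ultimately show ?thesis by simp
qed

text \<open>
  Given the number of \<open>g\<close>, search for a word that evaluates to \<open>g\<close> and evaluate the word with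
  the images of the letters. On numbers that represent nothing, the search condition is vacuous,
  so that the search always ends.
\<close>

lemma computable_hom:
  assumes \<nu>: "numbering G \<nu>" and \<mu>: "numbering H \<mu>" and H: "group H"
    and xs: "spanning G xs" and \<phi>: "\<phi> \<in> hom G H"
  shows "\<exists>f. computable f \<and> (\<forall>g\<in>carrier G. f (\<nu> g) = \<mu> (\<phi> g))"
proof -
  have xs': "set xs \<subseteq> carrier G" using xs by (simp add: spanning_def)
  then have map_xs: "set (map \<phi> xs) \<subseteq> carrier H" using \<phi> by (auto simp: hom_def)
  define e where "e c = \<nu> (word_prod G xs (list_decode c))" for c
  define e' where "e' c = \<mu> (word_prod H (map \<phi> xs) (list_decode c))" for c
  define s where "s x = (LEAST m. x \<in> \<nu> ` carrier G \<longrightarrow> e m = x)" for x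
  have e: "computable e" and e': "computable e'"
    unfolding e_def e'_def
    using computable_word_prod[OF \<nu> xs']
      plain_group.computable_word_prod[OF H[folded plain_group_iff] \<mu> map_xs] by blast+
  have ex: "\<exists>m. x \<in> \<nu> ` carrier G \<longrightarrow> e m = x" for x
    using xs unfolding e_def spanning_def by (metis (no_types, lifting) imageE list_encode_inverse)
  have s: "computable s"
    unfolding s_def using \<nu>
    by (intro computable_Least_pred ex decidable_pred_basic decidable_pred_mem computable_comp[OF e])
       (simp_all add: numbering_def)
  have "e' (s (\<nu> g)) = \<mu> (\<phi> g)" if g: "g \<in> carrier G" for g
  proof -
    have "e (s (\<nu> g)) = \<nu> g" unfolding s_def using LeastI_ex[OF ex[of "\<nu> g"]] g by blast
    then have "word_prod G xs (list_decode (s (\<nu> g))) = g"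
      using \<nu> g word_prod_closed[OF xs'] unfolding e_def numbering_def by (blast dest: inj_onD)
    then show ?thesis
      unfolding e'_def hom_word_prod[OF H \<phi> xs', symmetric] by simp
  qed
  with computable_comp[OF e' s] show ?thesis by blast
qed

lemma computable_inv:
  assumes \<nu>: "numbering G \<nu>"
  shows "\<exists>f. computable f \<and> (\<forall>g\<in>carrier G. f (\<nu> g) = \<nu> (inv g))"
proof -
  obtain f where f: "computable f"
      "\<And>g h. g \<in> carrier G \<Longrightarrow> h \<in> carrier G \<Longrightarrow> f (cpair (\<nu> g) (\<nu> h)) = \<nu> (g \<otimes> h)"
    using \<nu> unfolding numbering_def by blast
  let ?P = "\<lambda>x z. x \<in> \<nu> ` carrier G \<longrightarrow> z \<in> \<nu> ` carrier G \<and> f (cpair x z) = \<nu> \<one>"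
  have ex: "\<exists>z. ?P x z" for x
  proof (cases "x \<in> \<nu> ` carrier G")
    case True
    then obtain g where "g \<in> carrier G" "x = \<nu> g" by blast
    then show ?thesis by (intro exI[of _ "\<nu> (inv g)"]) (simp add: f(2))
  qed simp
  have "computable (\<lambda>x. LEAST z. ?P x z)"
    using \<nu>
    by (intro computable_Least_pred ex decidable_pred_basic decidable_pred_mem
        computable_comp[OF f(1)]) (simp_all add: numbering_def)
  moreover have "(LEAST z. ?P (\<nu> g) z) = \<nu> (inv g)" if g: "g \<in> carrier G" for g
  proof -
    have "?P (\<nu> g) (LEAST z. ?P (\<nu> g) z)" using LeastI_ex[OF ex] .
    then obtain h where h: "h \<in> carrier G" "(LEAST z. ?P (\<nu> g) z) = \<nu> h"
        "f (cpair (\<nu> g) (\<nu> h)) = \<nu> \<one>"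
      using g by auto
    then have "\<nu> (g \<otimes> h) = \<nu> \<one>" using f(2) g by simp
    then have "g \<otimes> h = \<one>" using \<nu> g h(1) unfolding numbering_def by (blast dest: inj_onD)
    then have "h = inv g" using g h(1) by (metis inv_equality inv_inv inv_closed)
    then show ?thesis using h(2) by simp
  qed
  ultimately show ?thesis by blast
qed

definition signed_letters :: "'a list \<Rightarrow> 'a list" where
  "signed_letters gs = map (letter_value G gs) [0..<2 * length gs]"

lemma signed_letters_closed:
  assumes "set gs \<subseteq> carrier G" shows "set (signed_letters gs) \<subseteq> carrier G"
proof -
  have "gs ! (j div 2) \<in> carrier G" if "j < 2 * length gs" for j
  proof -
    have "j div 2 < length gs" using that by linarith
    then show ?thesis using assms nth_mem by blast
  qed
  then show ?thesis by (auto simp: signed_letters_def letter_value_def)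
qed

lemma letter_at_signed: "j < 2 * length gs \<Longrightarrow> letter_at G (signed_letters gs) j = letter_value G gs j"
  by (simp add: letter_at_def signed_letters_def)

lemma word_value_eq:
  assumes "set gs \<subseteq> carrier G" "set w \<subseteq> {..<2 * length gs}"
  shows "word_value G gs w = word_prod G (signed_letters gs) w"
  using assms(2)
  by (induction w)
     (auto simp: word_value_def letter_at_signed word_prod_Cons signed_letters_closed[OF assms(1)])

lemma spanning_signed_letters:
  assumes gs: "set gs \<subseteq> carrier G" and gen: "generate G (set gs) = carrier G"
  shows "spanning G (signed_letters gs)"
  unfolding spanning_def
proof (intro conjI ballI)
  note cl = signed_letters_closed[OF gs]
  show "set (signed_letters gs) \<subseteq> carrier G" by (rule cl)
  fix g assume "g \<in> carrier G"
  then have "g \<in> generate G (set gs)" using gen by simp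
  then show "\<exists>w. word_prod G (signed_letters gs) w = g"
  proof induction
    case one
    then show ?case by (metis word_prod_Nil)
  next
    case (incl h)
    then obtain i where "i < length gs" "h = gs ! i" by (metis in_set_conv_nth)
    then show ?case
      by (intro exI[of _ "[2 * i]"])
         (simp add: word_prod_single[OF cl] letter_at_signed letter_value_def)
  next
    case (inv h)
    then obtain i where "i < length gs" "h = gs ! i" by (metis in_set_conv_nth)
    then show ?case
      by (intro exI[of _ "[2 * i + 1]"])
         (simp add: word_prod_single[OF cl] letter_at_signed letter_value_def)
  next
    case (eng h1 h2)
    then show ?case by (metis word_prod_append[OF cl])
  qed
qed

text \<open>
  A word represents the unit iff its value has the number of the unit. The function \<open>v\<close> in the
  proof is zero exactly on the words over the right alphabet.
\<close>

lemma numbering_word_problem: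
  assumes \<nu>: "numbering G \<nu>" and gs: "set gs \<subseteq> carrier G" "generate G (set gs) = carrier G"
  shows "fg_decidable_word_problem G"
proof -
  let ?W = "{w. set w \<subseteq> {..<2 * length gs} \<and> word_value G gs w = \<one>}"
  define v where "v c = foldl (\<lambda>a j. if j < 2 * length gs then a else 1) (0::nat) (list_decode c)" for c
  define e where "e c = \<nu> (word_prod G (signed_letters gs) (list_decode c))" for c
  have v: "computable v"
    unfolding v_def by (intro computable_foldl_list_decode decidable_pred_basic)
  have e: "computable e"
    unfolding e_def by (intro computable_word_prod \<nu> signed_letters_closed gs)
  have v_iff: "foldl (\<lambda>a j. if j < k then a else 1) (0::nat) w = 0 \<longleftrightarrow> set w \<subseteq> {..<k}" for k :: nat and w
    by (induction w rule: rev_induct) auto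
  have "list_encode w \<in> list_encode ` ?W \<longleftrightarrow> w \<in> ?W" for w
    by (simp add: inj_image_mem_iff[OF inj_list_encode])
  moreover have "w \<in> ?W \<longleftrightarrow> v (list_encode w) = 0 \<and> e (list_encode w) = \<nu> \<one>" for w
  proof -
    have "inj_on \<nu> (carrier G)" using \<nu> by (simp add: numbering_def)
    then show ?thesis
      using word_prod_closed[OF signed_letters_closed[OF gs(1)], of w]
      by (auto simp: v_def e_def v_iff word_value_eq[OF gs(1)] inj_on_eq_iff)
  qed
  ultimately have "list_encode w \<in> list_encode ` ?W \<longleftrightarrow>
      v (list_encode w) = 0 \<and> e (list_encode w) = \<nu> \<one>" for w
    by (rule trans)
  from this[of "list_decode c" for c]
  have "c \<in> list_encode ` ?W \<longleftrightarrow> v c = 0 \<and> e c = \<nu> \<one>" for c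
    by (simp only: list_decode_inverse)
  moreover have "decidable_pred (\<lambda>c. v c = 0 \<and> e c = \<nu> \<one>)"
    by (intro decidable_pred_basic v e)
  ultimately have "decidable (list_encode ` ?W)" by (simp only: decidable_iff)
  with gs show ?thesis unfolding fg_decidable_word_problem_def by blast
qed

text \<open>
  Unary notation turns a numbering into an encoding by words over the one-letter alphabet.
\<close>

lemma computable_encoding_unary:
  assumes \<nu>: "numbering G \<nu>"
  shows "computable_encoding G (\<lambda>g. replicate (\<nu> g) 0)"
proof -
  define u where "u n = list_encode (replicate n 0)" for n
  define len where "len c = length (list_decode c)" for c
  have "computable (\<lambda>n. rec_nat 0 (\<lambda>m r. Suc (cpair 0 r)) n)"
    by (intro computable_rec_nat computable_basic)
  moreover have "rec_nat 0 (\<lambda>m r. Suc (cpair 0 r)) n = u n" for n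
    by (induction n) (simp_all add: u_def cpair_def)
  ultimately have u: "computable u" by simp
  have "computable (\<lambda>c. foldl (\<lambda>a j. Suc a) 0 (list_decode c))"
    by (intro computable_foldl_list_decode computable_basic)
  moreover have "foldl (\<lambda>a j. Suc a) 0 w = length w" for w :: "nat list"
    by (induction w rule: rev_induct) simp_all
  ultimately have len: "computable len" by (simp add: len_def[abs_def])
  have len_u [simp]: "len (u n) = n" for n by (simp add: len_def u_def)
  have "c \<in> list_encode ` (\<lambda>g. replicate (\<nu> g) 0) ` carrier G \<longleftrightarrow> u (len c) = c \<and> len c \<in> \<nu> ` carrier G" for c
    by (auto simp: image_iff len_u u_def[symmetric]) 
  moreover have "decidable_pred (\<lambda>c. u (len c) = c \<and> len c \<in> \<nu> ` carrier G)"
    using \<nu> by (intro decidable_pred_basic decidable_pred_mem computable_comp[OF u] len)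
      (simp add: numbering_def)
  ultimately have dec: "decidable (list_encode ` (\<lambda>g. replicate (\<nu> g) 0) ` carrier G)"
    by (simp only: decidable_iff)
  obtain f where f: "computable f"
      "\<And>g h. g \<in> carrier G \<Longrightarrow> h \<in> carrier G \<Longrightarrow> f (cpair (\<nu> g) (\<nu> h)) = \<nu> (g \<otimes> h)"
    using \<nu> unfolding numbering_def by blast
  have "computable (\<lambda>p. u (f (cpair (len (cfst p)) (len (csnd p)))))"
    by (intro computable_comp[OF u] computable_comp[OF f(1)] computable_comp[OF len] computable_basic)
  then obtain F where F: "total_recursive 2 F" "\<And>x y. F [x, y] = u (f (cpair (len x) (len y)))"
    using computable_binary[of "\<lambda>x y. u (f (cpair (len x) (len y)))"] by auto
  obtain i where i: "computable i" "\<And>g. g \<in> carrier G \<Longrightarrow> i (\<nu> g) = \<nu> (inv g)"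
    using computable_inv[OF \<nu>] by blast
  have "computable (\<lambda>x. u (i (len x)))"
    by (intro computable_comp[OF u] computable_comp[OF i(1)] len)
  then obtain I where I: "total_recursive 1 I" "\<And>x. I [x] = u (i (len x))"
    unfolding computable_iff by blast
  show ?thesis
    unfolding computable_encoding_def
  proof (intro conjI dec)
    show "inj_on (\<lambda>g. replicate (\<nu> g) 0) (carrier G)"
      using \<nu> by (auto simp: numbering_def inj_on_def)
    show "\<exists>k. \<forall>g\<in>carrier G. set (replicate (\<nu> g) (0::nat)) \<subseteq> {..<k}"
      by (rule exI[of _ 1]) auto
    show "\<exists>f. total_recursive 2 f \<and> (\<forall>g\<in>carrier G. \<forall>h\<in>carrier G.
        f [list_encode (replicate (\<nu> g) 0), list_encode (replicate (\<nu> h) 0)] =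
          list_encode (replicate (\<nu> (g \<otimes> h)) 0))"
      using F by (intro exI[of _ F]) (simp add: f(2) flip: u_def)
    show "\<exists>f. total_recursive 1 f \<and> (\<forall>g\<in>carrier G.
        f [list_encode (replicate (\<nu> g) 0)] = list_encode (replicate (\<nu> (inv g)) 0))"
      using I by (intro exI[of _ I]) (simp add: i(2) flip: u_def)
  qed
qed

lemma computable_encoding_numbering:
  assumes "computable_encoding G enc"
  shows "numbering G (\<lambda>g. list_encode (enc g))"
proof -
  obtain F where F: "total_recursive 2 F" "\<And>g h. g \<in> carrier G \<Longrightarrow> h \<in> carrier G \<Longrightarrow>
      F [list_encode (enc g), list_encode (enc h)] = list_encode (enc (g \<otimes> h))"
    using assms unfolding computable_encoding_def by blast
  have "computable (\<lambda>p. F [cfst p, csnd p])"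
    using computable_binary[of "\<lambda>x y. F [x, y]"] F(1) by blast
  with F(2) assms show ?thesis
    unfolding numbering_def computable_encoding_def
    by (auto simp: inj_on_def list_encode_eq image_image intro!: exI[of _ "\<lambda>p. F [cfst p, csnd p]"])
qed

text \<open>
  The identity map of a finitely generated group is computable from one numbering to another, so
  a coded finite set can be recoded.
\<close>

lemma decidable_codes_transfer:
  assumes \<nu>: "numbering G \<nu>" and \<mu>: "numbering G \<mu>" and xs: "spanning G xs"
    and sub: "\<C> \<subseteq> Fpow (carrier G)" and dec: "decidable ((\<lambda>C. set_encode (\<nu> ` C)) ` \<C>)"
  shows "decidable ((\<lambda>C. set_encode (\<mu> ` C)) ` \<C>)"
proof -
  have inj: "inj_on \<nu> (carrier G)" "inj_on \<mu> (carrier G)"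
    using \<nu> \<mu> by (simp_all add: numbering_def)
  have "(\<lambda>g. g) \<in> hom G G" by (simp add: hom_def)
  then obtain t where t: "computable t" "\<And>g. g \<in> carrier G \<Longrightarrow> t (\<mu> g) = \<nu> g"
    using computable_hom[OF \<mu> \<nu> is_group xs] by blast
  let ?P = "\<lambda>D. (\<forall>x\<in>set_decode D. x \<in> \<mu> ` carrier G) \<and>
      (\<Sum>x | x < D \<and> x \<in> set_decode D. 2 ^ t x) \<in> (\<lambda>C. set_encode (\<nu> ` C)) ` \<C>"
  have "decidable_pred ?P"
    using \<mu>
    by (intro decidable_pred_conj decidable_pred_ball_set_decode decidable_pred_mem dec
        computable_sum_filter computable_power2 computable_comp[OF t(1)]
        decidable_pred_mem_set_decode computable_basic) (simp_all add: numbering_def)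
  moreover have "D \<in> (\<lambda>C. set_encode (\<mu> ` C)) ` \<C> \<longleftrightarrow> ?P D" for D
  proof (cases "\<forall>x\<in>set_decode D. x \<in> \<mu> ` carrier G")
    case True
    then obtain B where B: "B \<subseteq> carrier G" "set_decode D = \<mu> ` B"
      by (metis subset_imageE subsetI)
    then have fin: "finite B"
      by (metis finite_imageD finite_set_decode inj(2) inj_on_subset)
    have "t ` \<mu> ` B = \<nu> ` B" 
      unfolding image_image using B(1) t(2) by (intro image_cong) auto
    moreover have "inj_on (t \<circ> \<mu>) B"
      using inj_on_subset[OF inj(1) B(1)] B(1) t(2) by (subst inj_on_cong[of _ _ \<nu>]) auto
    then have "inj_on t (\<mu> ` B)" by (rule inj_on_imageI)
    moreover have "{x. x < D \<and> x \<in> set_decode D} = \<mu> ` B"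
      using set_decode_less B(2) by auto
    ultimately have sum: "(\<Sum>x | x < D \<and> x \<in> set_decode D. 2 ^ t x) = set_encode (\<nu> ` B)"
      by (simp add: set_encode_def sum.reindex flip: \<open>t ` \<mu> ` B = \<nu> ` B\<close>)
    have "B \<in> Fpow (carrier G)" using B(1) fin by (simp add: Fpow_def)
    note code_eq = code_mem_iff[OF _ sub this]
    have "D = set_encode (\<mu> ` B)" using B(2) by (metis set_decode_inverse)
    then show ?thesis using True sum code_eq inj by simp
  next
    case False
    have "set_decode D \<subseteq> \<mu> ` carrier G" if "D = set_encode (\<mu> ` C)" "C \<in> \<C>" for C
      using that sub by (auto simp: Fpow_def subset_iff)
    then show ?thesis using False by blast
  qed
  ultimately show ?thesis by (simp only: decidable_iff)
qed

end

section \<open>Convex geometries as separating closure systems\<close>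

text \<open>
  The last condition is anti-exchange in terms of closed sets. If \<open>D \<supseteq> C\<close> is closed and contains
  \<open>z\<close> but not \<open>y\<close>, then \<open>y\<close> is not in the hull of \<open>C \<union> {z}\<close>, and one such failure is all that
  anti-exchange asks for.
\<close>

definition convexity :: "'a set \<Rightarrow> 'a set set \<Rightarrow> bool" where
  "convexity X \<C> \<longleftrightarrow>
     \<C> \<subseteq> Fpow X \<and> {} \<in> \<C> \<and>
     (\<forall>B\<in>Fpow X. \<exists>C\<in>\<C>. B \<subseteq> C) \<and>
     (\<forall>\<A>. \<A> \<subseteq> \<C> \<longrightarrow> \<A> \<noteq> {} \<longrightarrow> \<Inter>\<A> \<in> \<C>) \<and>
     (\<forall>C\<in>\<C>. \<forall>y\<in>X - C. \<forall>z\<in>X - C. y \<noteq> z \<longrightarrow> (\<exists>D\<in>\<C>. C \<subseteq> D \<and> (y \<in> D \<longleftrightarrow> z \<notin> D)))"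

lemma convexityD:
  assumes "convexity X \<C>"
  shows "\<C> \<subseteq> Fpow X" "{} \<in> \<C>" "B \<in> Fpow X \<Longrightarrow> \<exists>C\<in>\<C>. B \<subseteq> C"
    "\<lbrakk>\<A> \<subseteq> \<C>; \<A> \<noteq> {}\<rbrakk> \<Longrightarrow> \<Inter>\<A> \<in> \<C>"
    "\<lbrakk>C \<in> \<C>; y \<in> X; y \<notin> C; z \<in> X; z \<notin> C; y \<noteq> z\<rbrakk> \<Longrightarrow>
      \<exists>D\<in>\<C>. C \<subseteq> D \<and> (y \<in> D \<longleftrightarrow> z \<notin> D)"
  using assms unfolding convexity_def by simp_all

definition hull :: "'a set set \<Rightarrow> 'a set \<Rightarrow> 'a set" where
  "hull \<C> B = \<Inter>{C \<in> \<C>. B \<subseteq> C}"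

definition midpoint_closed :: "'a monoid \<Rightarrow> 'a set \<Rightarrow> 'a set set \<Rightarrow> bool" where
  "midpoint_closed G S \<C> \<longleftrightarrow> (\<forall>C\<in>\<C>. \<forall>g\<in>carrier G. \<forall>h\<in>S.
     g \<otimes>\<^bsub>G\<^esub> h \<in> C \<longrightarrow> g \<otimes>\<^bsub>G\<^esub> inv\<^bsub>G\<^esub> h \<in> C \<longrightarrow> g \<in> C)"

lemma subset_hull: "B \<subseteq> hull \<C> B"
  and hull_least: "\<lbrakk>C \<in> \<C>; B \<subseteq> C\<rbrakk> \<Longrightarrow> hull \<C> B \<subseteq> C"
  by (auto simp: hull_def)

lemma hull_in:
  assumes "convexity X \<C>" "B \<in> Fpow X" shows "hull \<C> B \<in> \<C>"
proof -
  have "{C \<in> \<C>. B \<subseteq> C} \<noteq> {}" using convexityD(3)[OF assms] by blast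
  then show ?thesis unfolding hull_def by (intro convexityD(4)[OF assms(1)]) auto
qed

lemma hull_of_closed: "C \<in> \<C> \<Longrightarrow> hull \<C> C = C"
  by (auto simp: hull_def)

lemma convex_geometry_hull:
  assumes \<C>: "convexity (carrier G) \<C>"
  shows "convex_geometry G \<C> (hull \<C>)"
  unfolding convex_geometry_def
proof (intro conjI ballI impI)
  let ?X = "carrier G"
  have sub: "\<C> \<subseteq> Fpow ?X" and empty: "{} \<in> \<C>" using convexityD(1,2)[OF \<C>] .
  note closed = hull_in[OF \<C>]
  show "hull \<C> \<in> Fpow ?X \<rightarrow> Fpow ?X" using closed sub by blast
  show "\<C> = hull \<C> ` Fpow ?X"
  proof
    show "\<C> \<subseteq> hull \<C> ` Fpow ?X"
    proof
      fix C assume "C \<in> \<C>"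
      then show "C \<in> hull \<C> ` Fpow ?X"
        using sub by (intro image_eqI[of _ _ C]) (auto simp: hull_of_closed)
    qed
  qed (use closed in blast)
  show "hull \<C> {} = {}" using empty by (simp add: hull_of_closed)
  show "B \<subseteq> hull \<C> B" for B by (rule subset_hull)
  show "hull \<C> B \<subseteq> hull \<C> B'" if "B \<subseteq> B'" for B B'
    using that by (auto simp: hull_def)
  show "hull \<C> (hull \<C> B) = hull \<C> B" if "B \<in> Fpow ?X" for B
    using closed[OF that] by (rule hull_of_closed)
  show "z \<notin> hull \<C> (C \<union> {y})"
    if "C \<in> \<C>" "y \<in> ?X" "z \<in> ?X" and yz: "y \<noteq> z \<and> C \<inter> {y, z} = {} \<and> y \<in> hull \<C> (C \<union> {z})"
    for C y z
  proof -
    have "\<exists>D\<in>\<C>. C \<subseteq> D \<and> (y \<in> D \<longleftrightarrow> z \<notin> D)"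
      using that convexityD(5)[OF \<C>, of C y z] by blast
    then obtain D where "D \<in> \<C>" "C \<subseteq> D" "y \<in> D \<longleftrightarrow> z \<notin> D" by blast
    with yz show ?thesis
      using hull_least[of D \<C> "C \<union> {z}"] hull_least[of D \<C> "C \<union> {y}"] by blast
  qed
qed

lemma midpointed_hull:
  assumes "midpoint_closed G S \<C>" shows "midpointed G S (hull \<C>)"
  using assms by (auto simp: midpoint_closed_def midpointed_def hull_def)

lemma (in group) mem_l_coset_iff:
  assumes "C \<subseteq> carrier G" "a \<in> carrier G"
  shows "x \<in> a <# C \<longleftrightarrow> x \<in> carrier G \<and> inv a \<otimes> x \<in> C"
proof
  assume "x \<in> a <# C"
  then obtain c where "c \<in> C" "x = a \<otimes> c" by (auto simp: l_coset_def)
  then show "x \<in> carrier G \<and> inv a \<otimes> x \<in> C" using assms by (auto simp: inv_solve_left' m_assoc[symmetric])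
next
  assume "x \<in> carrier G \<and> inv a \<otimes> x \<in> C"
  then have "x = a \<otimes> (inv a \<otimes> x)" "inv a \<otimes> x \<in> C" using assms by (simp_all add: m_assoc[symmetric])
  then show "x \<in> a <# C" unfolding l_coset_def by blast
qed

section \<open>Layered convex sets in an extension by the integers\<close>

locale z_extension = K: group K + G: group G
  for K :: "'b monoid" and G :: "'a monoid" (structure) +
  fixes i :: "'b \<Rightarrow> 'a" and p :: "'a \<Rightarrow> int"
  assumes i_mon: "i \<in> mon K G" and p_epi: "p \<in> epi G integer_group"
    and exact: "i ` carrier K = kernel G integer_group p"
begin

lemma i_hom: "i \<in> hom K G" and i_inj: "inj_on i (carrier K)"
  using i_mon by (auto simp: mon_def)

lemma i_closed [simp]: "x \<in> carrier K \<Longrightarrow> i x \<in> carrier G"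
  using i_hom by (auto simp: hom_def)

lemma i_mult [simp]: "\<lbrakk>x \<in> carrier K; y \<in> carrier K\<rbrakk> \<Longrightarrow> i (x \<otimes>\<^bsub>K\<^esub> y) = i x \<otimes> i y"
  using i_hom by (auto simp: hom_def)

lemma i_one [simp]: "i \<one>\<^bsub>K\<^esub> = \<one>"
  using hom_one[OF i_hom K.is_group G.is_group] .

lemma i_inv [simp]: "x \<in> carrier K \<Longrightarrow> i (inv\<^bsub>K\<^esub> x) = inv (i x)"
  by (metis G.inv_equality K.inv_closed K.l_inv i_closed i_mult i_one)

lemma p_mult [simp]: "\<lbrakk>g \<in> carrier G; h \<in> carrier G\<rbrakk> \<Longrightarrow> p (g \<otimes> h) = p g + p h"
  using p_epi by (auto simp: epi_def hom_def)

lemma p_one [simp]: "p \<one> = 0"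
  using p_mult[of \<one> \<one>] by simp

lemma p_inv [simp]: "g \<in> carrier G \<Longrightarrow> p (inv g) = - p g"
  using p_mult[of g "inv g"] by simp

lemma p_surj: "\<exists>g\<in>carrier G. p g = n"
proof -
  have "n \<in> p ` carrier G" using p_epi by (simp add: epi_def)
  then show ?thesis by blast
qed

lemma p_i [simp]: "x \<in> carrier K \<Longrightarrow> p (i x) = 0"
proof -
  assume "x \<in> carrier K"
  then have "i x \<in> kernel G integer_group p" using exact by blast
  then show "p (i x) = 0" by (simp add: kernel_def)
qed

lemma same_height:
  assumes "g \<in> carrier G" "g' \<in> carrier G" "p g = p g'"
  obtains x where "x \<in> carrier K" "g' = g \<otimes> i x"
proof -
  have "inv g \<otimes> g' \<in> i ` carrier K"
    using assms by (simp add: exact kernel_def)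
  then obtain x where x: "x \<in> carrier K" "inv g \<otimes> g' = i x" by blast
  then have "g' = g \<otimes> i x"
    using assms by (metis G.inv_closed G.inv_solve_left G.inv_inv G.m_closed i_closed)
  with x show ?thesis using that by blast
qed

text \<open>
  The layer of \<open>C\<close> at the height of \<open>g\<close>, seen in \<open>K\<close> with \<open>g\<close> as base point.
\<close>

definition fiber :: "'a \<Rightarrow> 'a set \<Rightarrow> 'b set" where
  "fiber g C = {x \<in> carrier K. g \<otimes> i x \<in> C}"

lemma fiber_empty [simp]: "fiber g {} = {}"
  by (simp add: fiber_def)

lemma fiber_Inter: "\<A> \<noteq> {} \<Longrightarrow> fiber g (\<Inter>\<A>) = \<Inter>(fiber g ` \<A>)"
  by (auto simp: fiber_def)

text \<open>
  Another base point at the same height changes a fiber by a left translation of \<open>K\<close>. Hence for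
  an invariant family on \<open>K\<close> it does not matter which base point is used.
\<close>

lemma fiber_shift:
  assumes "g \<in> carrier G" "k \<in> carrier K"
  shows "fiber (g \<otimes> i k) C = inv\<^bsub>K\<^esub> k <#\<^bsub>K\<^esub> fiber g C"
proof (rule Set.set_eqI)
  fix x
  have "g \<otimes> i k \<otimes> i x = g \<otimes> i (k \<otimes>\<^bsub>K\<^esub> x)" if "x \<in> carrier K"
    using that assms by (simp add: G.m_assoc)
  then show "x \<in> fiber (g \<otimes> i k) C \<longleftrightarrow> x \<in> inv\<^bsub>K\<^esub> k <#\<^bsub>K\<^esub> fiber g C"
    using assms(2) by (subst K.mem_l_coset_iff) (auto simp: fiber_def)
qed

lemma fiber_coset:
  assumes "g \<in> carrier G" "a \<in> carrier G" "C \<subseteq> carrier G"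
  shows "fiber g (a <# C) = fiber (inv a \<otimes> g) C"
  using assms by (auto simp: fiber_def G.mem_l_coset_iff G.m_assoc)

lemma finite_fiber:
  assumes "finite C" "g \<in> carrier G" shows "finite (fiber g C)"
proof (rule finite_imageD)
  show "finite ((\<lambda>x. g \<otimes> i x) ` fiber g C)"
    by (rule finite_subset[OF _ assms(1)]) (auto simp: fiber_def)
  show "inj_on (\<lambda>x. g \<otimes> i x) (fiber g C)"
    using assms(2) i_inj by (auto simp: inj_on_def fiber_def)
qed

end

locale layered_convexity = z_extension K G i p
  for K :: "'b monoid" and G :: "'a monoid" (structure) and i p +
  fixes \<K> :: "'b set set" and T :: "'a set"
  assumes \<K>: "convexity (carrier K) \<K>" and \<K>_inv: "invariant_family K \<K>"
    and T: "finite T" "T \<subseteq> carrier G" "\<And>h. h \<in> T \<Longrightarrow> p h > 0"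
begin

definition layered :: "'a set set" where
  "layered = {C \<in> Fpow (carrier G). (\<forall>g\<in>carrier G. fiber g C \<in> \<K>) \<and>
     (\<forall>c\<in>C. \<forall>z\<in>C. \<forall>h\<in>T. p z < p c - p h \<longrightarrow> c \<otimes> inv h \<in> C)}"

text \<open>
  Sets that obey the downward rule at all heights from \<open>n\<close> on, whether or not there are lower
  points. Unlike convexity this does not depend on what is added below height \<open>n\<close>, so convex
  sets can be built from the top down.
\<close>

definition closed_above :: "int \<Rightarrow> 'a set \<Rightarrow> bool" where
  "closed_above n U \<longleftrightarrow> U \<in> Fpow (carrier G) \<and> (\<forall>u\<in>U. n \<le> p u) \<and>
     (\<forall>g\<in>carrier G. fiber g U \<in> \<K>) \<and>
     (\<forall>c\<in>U. \<forall>h\<in>T. n \<le> p c - p h \<longrightarrow> c \<otimes> inv h \<in> U)"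

definition layer :: "'a \<Rightarrow> 'b set \<Rightarrow> 'a set" where
  "layer g Q = (\<lambda>x. g \<otimes> i x) ` Q"

lemma \<K>_sub: "Q \<in> \<K> \<Longrightarrow> Q \<subseteq> carrier K \<and> finite Q"
  and \<K>_empty: "{} \<in> \<K>"
  and \<K>_cover: "finite B \<Longrightarrow> B \<subseteq> carrier K \<Longrightarrow> \<exists>Q\<in>\<K>. B \<subseteq> Q"
  using convexityD(1-3)[OF \<K>] by (auto simp: Fpow_def)

lemma fiber_same_height:
  assumes "g \<in> carrier G" "a \<in> carrier G" "p g = p a" "fiber g C \<in> \<K>"
  shows "fiber a C \<in> \<K>"
proof -
  obtain k where k: "k \<in> carrier K" "a = g \<otimes> i k" using same_height[OF assms(1-3)] .
  then show ?thesis
    using assms(1,4) \<K>_inv by (simp add: fiber_shift invariant_family_def)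
qed

lemma fiber_subset_height:
  assumes "\<forall>g\<in>carrier G. fiber g C \<in> \<K>" "g \<in> carrier G"
  shows "fiber g {c \<in> C. P (p c)} \<in> \<K>"
proof -
  have "fiber g {c \<in> C. P (p c)} = (if P (p g) then fiber g C else {})"
    using assms(2) by (auto simp: fiber_def)
  then show ?thesis using assms \<K>_empty by simp
qed

lemma layer_props:
  assumes "Q \<in> \<K>" "g \<in> carrier G"
  shows "layer g Q \<in> Fpow (carrier G)" "\<And>u. u \<in> layer g Q \<Longrightarrow> p u = p g"
    "\<And>x. x \<in> carrier K \<Longrightarrow> g \<otimes> i x \<in> layer g Q \<longleftrightarrow> x \<in> Q"
proof -
  have Q: "Q \<subseteq> carrier K" "finite Q" using \<K>_sub assms(1) by auto
  then show "layer g Q \<in> Fpow (carrier G)" using assms(2) by (auto simp: layer_def Fpow_def)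
  show "p u = p g" if "u \<in> layer g Q" for u
    using that Q(1) assms(2) by (auto simp: layer_def subset_iff)
  show "g \<otimes> i x \<in> layer g Q \<longleftrightarrow> x \<in> Q" if "x \<in> carrier K" for x
  proof -
    have "q = x" if "q \<in> Q" "g \<otimes> i x = g \<otimes> i q" for q
    proof -
      have "q \<in> carrier K" using that(1) Q(1) by blast
      moreover from this have "i x = i q" using that(2) assms(2) \<open>x \<in> carrier K\<close> by simp
      ultimately show ?thesis using i_inj \<open>x \<in> carrier K\<close> by (simp add: inj_on_eq_iff)
    qed
    then show ?thesis unfolding layer_def by blast
  qed
qed

lemma fiber_add_layer:
  assumes U: "\<forall>g\<in>carrier G. fiber g U \<in> \<K>" and low: "\<forall>u\<in>U. p g < p u"
    and Q: "Q \<in> \<K>" and g: "g \<in> carrier G" and a: "a \<in> carrier G"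
  shows "fiber a (U \<union> layer g Q) \<in> \<K>"
proof (cases "p a = p g")
  case True
  have "fiber g (U \<union> layer g Q) = Q"
    using layer_props(3)[OF Q g] \<K>_sub[OF Q] low g by (auto simp: fiber_def)
  then show ?thesis using fiber_same_height[OF g a] True Q by simp
next
  case False
  have "fiber a (U \<union> layer g Q) = fiber a U"
    using layer_props(2)[OF Q g] a False by (fastforce simp: fiber_def)
  then show ?thesis using U a by simp
qed

lemma closed_above_layered: "closed_above n U \<Longrightarrow> U \<in> layered"
  unfolding closed_above_def layered_def by force

text \<open>
  A point of \<open>C\<close> below \<open>n\<close> makes the rule of \<open>layered\<close> unconditional from height \<open>n\<close> on.
\<close>

lemma closed_above_truncate:
  assumes C: "C \<in> layered" and z: "z \<in> C" "p z < n"
  shows "closed_above n {c \<in> C. n \<le> p c}"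
  unfolding closed_above_def
proof (intro conjI ballI impI)
  show "{c \<in> C. n \<le> p c} \<in> Fpow (carrier G)" using C by (auto simp: layered_def Fpow_def)
  show "fiber g {c \<in> C. n \<le> p c} \<in> \<K>" if "g \<in> carrier G" for g
    using C that by (intro fiber_subset_height) (auto simp: layered_def)
  show "c \<otimes> inv h \<in> {c \<in> C. n \<le> p c}"
    if "c \<in> {c \<in> C. n \<le> p c}" "h \<in> T" "n \<le> p c - p h" for c h
  proof -
    have "c \<in> carrier G" "h \<in> carrier G" using that C T(2) by (auto simp: layered_def Fpow_def)
    moreover have "c \<otimes> inv h \<in> C" using C z that unfolding layered_def by force
    ultimately show ?thesis using that by simp
  qed
qed simp

text \<open>
  The lowest layer may be any convex set of \<open>K\<close>, because the rule does not force points into the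
  lowest layer.
\<close>

lemma layered_bottom_layer:
  assumes U: "closed_above (n + 1) U" and Q: "Q \<in> \<K>" and g: "g \<in> carrier G" "p g = n"
  shows "U \<union> layer g Q \<in> layered"
  unfolding layered_def
proof (intro CollectI conjI ballI impI)
  note props = layer_props[OF Q g(1)]
  show "U \<union> layer g Q \<in> Fpow (carrier G)"
    using U props(1) by (auto simp: closed_above_def Fpow_def)
  show "fiber a (U \<union> layer g Q) \<in> \<K>" if "a \<in> carrier G" for a
    using U g that Q by (intro fiber_add_layer) (auto simp: closed_above_def)
  show "c \<otimes> inv h \<in> U \<union> layer g Q"
    if "c \<in> U \<union> layer g Q" "z \<in> U \<union> layer g Q" "h \<in> T" "p z < p c - p h" for c z h
  proof -
    have "n \<le> p z" using that(2) U props(2) g by (auto simp: closed_above_def)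
    \<comment> \<open>a point forced from the bottom layer would be lower than every point present\<close>
    moreover have "c \<notin> layer g Q" using calculation that T(3)[of h] props(2) g by force
    ultimately show ?thesis using that U by (auto simp: closed_above_def)
  qed
qed

text \<open>
  A layer that is not meant to be the lowest one must receive the points forced by the layers
  above it.
\<close>

lemma closed_above_add_layer:
  assumes U: "closed_above (n + 1) U" and Q: "Q \<in> \<K>" and g: "g \<in> carrier G" "p g = n"
    and req: "\<And>c h. \<lbrakk>c \<in> U; h \<in> T; p c - p h = n\<rbrakk> \<Longrightarrow> c \<otimes> inv h \<in> layer g Q"
  shows "closed_above n (U \<union> layer g Q)"
  unfolding closed_above_def
proof (intro conjI ballI impI)
  note props = layer_props[OF Q g(1)]
  show "U \<union> layer g Q \<in> Fpow (carrier G)"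
    using U props(1) by (auto simp: closed_above_def Fpow_def)
  show "fiber a (U \<union> layer g Q) \<in> \<K>" if "a \<in> carrier G" for a
    using U g that Q by (intro fiber_add_layer) (auto simp: closed_above_def)
  show "n \<le> p u" if "u \<in> U \<union> layer g Q" for u
    using that U props(2) g by (auto simp: closed_above_def)
  show "c \<otimes> inv h \<in> U \<union> layer g Q"
    if "c \<in> U \<union> layer g Q" "h \<in> T" "n \<le> p c - p h" for c h
  proof -
    \<comment> \<open>the rule moves a point strictly down, so the new layer forces nothing at height n or above\<close>
    have "c \<notin> layer g Q" using that T(3)[of h] props(2) g by force
    then have "c \<in> U" using that by blast
    then show ?thesis
      using that U req[of c h] by (cases "p c - p h = n") (auto simp: closed_above_def)
  qed
qed

text \<open>
  Adding layers one by one, each a convex set of \<open>K\<close> that contains the wanted points of \<open>B\<close> and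
  the points forced from above, reaches any height \<open>a\<close> after finitely many steps. The part at
  height \<open>a + k\<close> and above stays as it was.
\<close>

lemma extend_down:
  assumes "closed_above (a + int k) U" "B \<in> Fpow (carrier G)"
  shows "\<exists>E. closed_above a E \<and> U \<subseteq> E \<and> (\<forall>e\<in>E. a + int k \<le> p e \<longrightarrow> e \<in> U) \<and>
    (\<forall>b\<in>B. a \<le> p b \<longrightarrow> p b < a + int k \<longrightarrow> b \<in> E)"
  using assms(1)
proof (induction k arbitrary: U)
  case 0
  then show ?case by (intro exI[of _ U]) auto
next
  case (Suc k)
  let ?n = "a + int k"
  have U: "closed_above (?n + 1) U" using Suc.prems by (simp add: algebra_simps)
  obtain g where g: "g \<in> carrier G" "p g = ?n" using p_surj by blast
  let ?R = "(\<lambda>(c, h). c \<otimes> inv h) ` (U \<times> T)"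
  have fin: "finite (B \<union> ?R)" using assms(2) U T(1) by (auto simp: closed_above_def Fpow_def)
  have "\<exists>Q\<in>\<K>. fiber g (B \<union> ?R) \<subseteq> Q"
    by (intro \<K>_cover finite_fiber fin g) (auto simp: fiber_def)
  then obtain Q where Q: "Q \<in> \<K>" "fiber g (B \<union> ?R) \<subseteq> Q" by blast
  have in_layer: "b \<in> layer g Q" if "b \<in> B \<union> ?R" "b \<in> carrier G" "p b = ?n" for b
  proof -
    have "p g = p b" using g that(3) by simp
    then obtain x where "x \<in> carrier K" "b = g \<otimes> i x"
      using same_height[OF g(1) \<open>b \<in> carrier G\<close>] by blast
    then have "x \<in> fiber g (B \<union> ?R)" using that(1) by (simp add: fiber_def del: Un_iff)
    then show ?thesis using Q(2) \<open>b = g \<otimes> i x\<close> by (auto simp: layer_def simp del: Un_iff)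
  qed
  have "closed_above ?n (U \<union> layer g Q)"
  proof (rule closed_above_add_layer[OF U Q(1) g])
    fix c h assume "c \<in> U" "h \<in> T" "p c - p h = ?n"
    moreover from this have "c \<in> carrier G" "h \<in> carrier G"
      using U T(2) by (auto simp: closed_above_def Fpow_def)
    ultimately show "c \<otimes> inv h \<in> layer g Q" by (intro in_layer) auto
  qed
  from Suc.IH[OF this] obtain E where E: "closed_above a E" "U \<union> layer g Q \<subseteq> E"
    "\<forall>e\<in>E. ?n \<le> p e \<longrightarrow> e \<in> U \<union> layer g Q" "\<forall>b\<in>B. a \<le> p b \<longrightarrow> p b < ?n \<longrightarrow> b \<in> E"
    by blast
  show ?case
  proof (intro exI[of _ E] conjI ballI impI)
    show "e \<in> U" if "e \<in> E" "a + int (Suc k) \<le> p e" for e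
      using that E(3) layer_props(2)[OF Q(1) g(1)] g(2) by force
    show "b \<in> E" if "b \<in> B" "a \<le> p b" "p b < a + int (Suc k)" for b
    proof (cases "p b = ?n")
      case True
      then have "b \<in> layer g Q" using that assms(2) by (intro in_layer) (auto simp: Fpow_def)
      then show ?thesis using E(2) by blast
    qed (use that E(4) in auto)
  qed (use E in auto)
qed

lemma closed_above_cover:
  assumes B: "B \<in> Fpow (carrier G)" and low: "\<forall>b\<in>B. a \<le> p b"
  shows "\<exists>E. closed_above a E \<and> B \<subseteq> E"
proof -
  define k where "k = nat (Max (insert 0 ((\<lambda>b. p b - a) ` B)) + 1)"
  have "p b < a + int k" if "b \<in> B" for b
  proof -
    have "finite B" using B by (simp add: Fpow_def)
    then have "p b - a \<le> Max (insert 0 ((\<lambda>b. p b - a) ` B))" using that by simp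
    then show ?thesis unfolding k_def by linarith
  qed
  moreover have "closed_above (a + int k) {}"
    by (simp add: closed_above_def Fpow_def \<K>_empty)
  from extend_down[OF this B] obtain E where "closed_above a E"
      "\<forall>b\<in>B. a \<le> p b \<longrightarrow> p b < a + int k \<longrightarrow> b \<in> E" by blast
  ultimately show ?thesis using low by blast
qed

text \<open>
  If \<open>C\<close> has a point at the height of \<open>z\<close> or lower, adding \<open>z\<close> changes only layers that are not
  higher than \<open>z\<close>, and so does not add \<open>y\<close>. Otherwise some convex set contains \<open>C\<close> and \<open>y\<close>, and
  all its points are higher than \<open>z\<close>.
\<close>

lemma separate_heights:
  assumes C: "C \<in> layered" and y: "y \<in> carrier G" "y \<notin> C" and z: "z \<in> carrier G"
    and less: "p z < p y"
  shows "\<exists>D\<in>layered. C \<subseteq> D \<and> (y \<in> D \<longleftrightarrow> z \<notin> D)"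
proof (cases "\<exists>c\<in>C. p c \<le> p z")
  case True
  have C_fin: "finite C" "C \<subseteq> carrier G" using C by (auto simp: layered_def Fpow_def)
  define a where "a = Min (p ` C)"
  have a_le: "a \<le> p c" if "c \<in> C" for c using that C_fin by (simp add: a_def)
  obtain k where k: "p z + 1 = a + int k"
    using True a_le by (metis zle_iff_zadd order_trans zle_add1_eq_le less_imp_le)
  have "closed_above (p z + 1) {c \<in> C. p z + 1 \<le> p c}"
    using True C closed_above_truncate by force
  moreover have "insert z C \<in> Fpow (carrier G)" using C_fin z by (simp add: Fpow_def)
  ultimately obtain E where E: "closed_above a E" "{c \<in> C. p z + 1 \<le> p c} \<subseteq> E"
      "\<forall>e\<in>E. p z + 1 \<le> p e \<longrightarrow> e \<in> C" "\<forall>b\<in>insert z C. a \<le> p b \<longrightarrow> p b < p z + 1 \<longrightarrow> b \<in> E"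
    using extend_down[of a k "{c \<in> C. p z + 1 \<le> p c}" "insert z C"] unfolding k by blast
  have "C \<subseteq> E"
  proof
    fix c assume "c \<in> C"
    then show "c \<in> E" using E(2,4) a_le by (cases "p z + 1 \<le> p c") auto
  qed
  moreover have "z \<in> E" using E(4) True a_le by force
  moreover have "y \<notin> E" using E(3) y(2) less by force
  ultimately show ?thesis using closed_above_layered[OF E(1)] by blast
next
  case False
  have "insert y C \<in> Fpow (carrier G)" using C y by (auto simp: layered_def Fpow_def)
  moreover have "\<forall>b\<in>insert y C. p z + 1 \<le> p b" using False less by force
  ultimately obtain E where E: "closed_above (p z + 1) E" "insert y C \<subseteq> E"
    using closed_above_cover by blast
  then have "z \<notin> E" by (auto simp: closed_above_def)
  then show ?thesis using closed_above_layered[OF E(1)] E(2) by blast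
qed

text \<open>
  Write \<open>y = z \<otimes> i x\<close>. A convex set \<open>Q\<close> of \<open>K\<close> that contains the fiber of \<open>C\<close> and exactly one of
  \<open>x\<close> and the unit becomes the layer at the height of \<open>z\<close>. If \<open>C\<close> has lower points, \<open>Q\<close> already
  contains all points forced from above, and the layers below are completed. Otherwise this
  layer is the lowest one, and the part of \<open>C\<close> above it is enlarged until it obeys the downward
  rule.
\<close>

lemma separate_same_height:
  assumes C: "C \<in> layered" and y: "y \<in> carrier G" "y \<notin> C" and z: "z \<in> carrier G" "z \<notin> C"
    and eq: "p z = p y" and neq: "y \<noteq> z"
  shows "\<exists>D\<in>layered. C \<subseteq> D \<and> (y \<in> D \<longleftrightarrow> z \<notin> D)"
proof -
  have C_fin: "finite C" "C \<subseteq> carrier G" using C by (auto simp: layered_def Fpow_def)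
  obtain x where x: "x \<in> carrier K" "y = z \<otimes> i x" using same_height[OF z(1) y(1) eq] .
  have fib: "fiber z C \<in> \<K>" using C z by (auto simp: layered_def)
  have "x \<noteq> \<one>\<^bsub>K\<^esub>" using x neq z by auto
  moreover have "x \<notin> fiber z C" "\<one>\<^bsub>K\<^esub> \<notin> fiber z C" using x y z by (auto simp: fiber_def)
  ultimately obtain Q where Q: "Q \<in> \<K>" "fiber z C \<subseteq> Q" "x \<in> Q \<longleftrightarrow> \<one>\<^bsub>K\<^esub> \<notin> Q"
    using convexityD(5)[OF \<K> fib x(1), of "\<one>\<^bsub>K\<^esub>"] by auto
  note props = layer_props[OF Q(1) z(1)]
  have y_iff: "y \<in> layer z Q \<longleftrightarrow> x \<in> Q" using props(3)[OF x(1)] x(2) by simp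
  have z_iff: "z \<in> layer z Q \<longleftrightarrow> \<one>\<^bsub>K\<^esub> \<in> Q" using props(3)[of "\<one>\<^bsub>K\<^esub>"] z(1) by simp
  have in_layer: "c \<in> layer z Q" if "c \<in> C" "p c = p z" for c
  proof -
    have "c \<in> carrier G" "p z = p c" using that C_fin by auto
    then obtain q where "q \<in> carrier K" "c = z \<otimes> i q" using same_height[OF z(1)] by blast
    then have "q \<in> fiber z C" using that(1) by (simp add: fiber_def)
    then show ?thesis using Q(2) \<open>c = z \<otimes> i q\<close> by (auto simp: layer_def)
  qed
  show ?thesis
  proof (cases "\<exists>c\<in>C. p c < p z")
    case True
    define a where "a = Min (p ` C)"
    have a_le: "a \<le> p c" if "c \<in> C" for c using that C_fin by (simp add: a_def)
    obtain k where k: "p z = a + int k"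
      using True a_le by (metis zle_iff_zadd order_trans less_imp_le)
    let ?U = "{c \<in> C. p z + 1 \<le> p c}"
    have U: "closed_above (p z + 1) ?U"
      using True C closed_above_truncate by force
    have "closed_above (p z) (?U \<union> layer z Q)"
    proof (rule closed_above_add_layer[OF U Q(1) z(1) refl])
      fix c h assume ch: "c \<in> ?U" "h \<in> T" "p c - p h = p z"
      moreover have "c \<in> carrier G" "h \<in> carrier G" using ch C_fin T(2) by auto
      moreover have "c \<otimes> inv h \<in> C" using True C ch unfolding layered_def by force
      ultimately show "c \<otimes> inv h \<in> layer z Q" by (intro in_layer) auto
    qed
    moreover have "C \<in> Fpow (carrier G)" using C_fin by (simp add: Fpow_def)
    ultimately obtain E where E: "closed_above a E" "?U \<union> layer z Q \<subseteq> E"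
        "\<forall>e\<in>E. p z \<le> p e \<longrightarrow> e \<in> ?U \<union> layer z Q"
        "\<forall>b\<in>C. a \<le> p b \<longrightarrow> p b < p z \<longrightarrow> b \<in> E"
      using extend_down[of a k "?U \<union> layer z Q" C] unfolding k by blast
    have "C \<subseteq> E"
    proof
      fix c assume c: "c \<in> C"
      show "c \<in> E"
      proof (cases "p c = p z")
        case True then show ?thesis using in_layer[OF c] E(2) by blast
      next
        case False then show ?thesis using c E(2,4) a_le by (cases "p z + 1 \<le> p c") auto
      qed
    qed
    moreover have "y \<in> E \<longleftrightarrow> x \<in> Q" "z \<in> E \<longleftrightarrow> \<one>\<^bsub>K\<^esub> \<in> Q"
      using E(2,3) y(2) z(2) eq y_iff z_iff by force+
    ultimately show ?thesis using closed_above_layered[OF E(1)] Q(3) by blast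
  next
    case False
    let ?B = "{c \<in> C. p z + 1 \<le> p c}"
    have "?B \<in> Fpow (carrier G)" "\<forall>b\<in>?B. p z + 1 \<le> p b"
      using C_fin by (auto simp: Fpow_def)
    then obtain U where U: "closed_above (p z + 1) U" "?B \<subseteq> U"
      using closed_above_cover by blast
    let ?D = "U \<union> layer z Q"
    have "?D \<in> layered" by (rule layered_bottom_layer[OF U(1) Q(1) z(1) refl])
    moreover have "C \<subseteq> ?D"
    proof
      fix c assume "c \<in> C"
      then show "c \<in> ?D" using False in_layer[of c] U(2) by (cases "p c = p z") force+
    qed
    moreover have "y \<notin> U" "z \<notin> U" using U(1) eq by (auto simp: closed_above_def)
    ultimately show ?thesis using Q(3) y_iff z_iff by blast
  qed
qed

theorem convexity_layered: "convexity (carrier G) layered"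
  unfolding convexity_def
proof (intro conjI ballI allI impI)
  show "layered \<subseteq> Fpow (carrier G)" by (auto simp: layered_def)
  show "{} \<in> layered" by (simp add: layered_def Fpow_def \<K>_empty)
  show "\<exists>C\<in>layered. B \<subseteq> C" if B: "B \<in> Fpow (carrier G)" for B
  proof -
    have "\<forall>b\<in>B. Min (p ` B) \<le> p b" using B by (auto simp: Fpow_def)
    then show ?thesis using closed_above_cover[OF B] closed_above_layered by blast
  qed
  show "\<Inter>\<A> \<in> layered" if \<A>: "\<A> \<subseteq> layered" "\<A> \<noteq> {}" for \<A>
  proof -
    have "\<Inter>\<A> \<in> Fpow (carrier G)"
      using \<A> by (fastforce simp: layered_def Fpow_def intro: finite_subset[OF Inter_lower])
    moreover have "fiber g (\<Inter>\<A>) \<in> \<K>" if g: "g \<in> carrier G" for g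
    proof -
      have "fiber g ` \<A> \<subseteq> \<K>" using \<A>(1) g by (auto simp: layered_def)
      then show ?thesis
        using \<A>(2) unfolding fiber_Inter[OF \<A>(2)] by (intro convexityD(4)[OF \<K>]) auto
    qed
    ultimately show ?thesis using \<A>(1) unfolding layered_def by blast
  qed
  show "\<exists>D\<in>layered. C \<subseteq> D \<and> (y \<in> D \<longleftrightarrow> z \<notin> D)"
    if "C \<in> layered" "y \<in> carrier G - C" "z \<in> carrier G - C" "y \<noteq> z" for C y z
    using that separate_heights[of C y z] separate_heights[of C z y] separate_same_height[of C y z]
    by (cases "p z" "p y" rule: linorder_cases) blast+
qed

lemma invariant_layered: "invariant_family G layered"
  unfolding invariant_family_def
proof (intro ballI)
  fix C a assume C: "C \<in> layered" and a: "a \<in> carrier G"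
  have C_sub: "C \<subseteq> carrier G" "finite C" using C by (auto simp: layered_def Fpow_def)
  show "a <# C \<in> layered"
    unfolding layered_def
  proof (intro CollectI conjI ballI impI)
    show "a <# C \<in> Fpow (carrier G)"
      using C_sub a by (auto simp: Fpow_def l_coset_def)
    show "fiber g (a <# C) \<in> \<K>" if "g \<in> carrier G" for g
      using that C a C_sub by (simp add: fiber_coset layered_def)
    fix c z h assume *: "c \<in> a <# C" "z \<in> a <# C" "h \<in> T" "p z < p c - p h"
    then obtain c' z' where "c' \<in> C" "c = a \<otimes> c'" "z' \<in> C" "z = a \<otimes> z'"
      by (auto simp: l_coset_def)
    moreover from this have "c' \<in> carrier G" "z' \<in> carrier G" using C_sub by auto
    moreover have h: "h \<in> carrier G" using * T(2) by blast
    ultimately have "p z' < p c' - p h" using *(4) a by simp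
    then have "c' \<otimes> inv h \<in> C" using C *(3) \<open>c' \<in> C\<close> \<open>z' \<in> C\<close> by (auto simp: layered_def)
    moreover have "c \<otimes> inv h = a \<otimes> (c' \<otimes> inv h)"
      using \<open>c = _\<close> \<open>c' \<in> carrier G\<close> h a by (simp add: G.m_assoc)
    ultimately show "c \<otimes> inv h \<in> a <# C" by (auto simp: l_coset_def)
  qed
qed

text \<open>
  For \<open>h\<close> of positive height, \<open>g = (g \<otimes> h) \<otimes> inv h\<close> is forced by \<open>g \<otimes> h\<close>, with \<open>g \<otimes> inv h\<close> as
  the lower point; for negative height the roles are exchanged. Height zero is the midpoint
  property of \<open>K\<close>.
\<close>

lemma midpoint_closed_layered:
  assumes S: "S \<subseteq> carrier G"
    and T_S: "\<And>h. \<lbrakk>h \<in> S; p h > 0\<rbrakk> \<Longrightarrow> h \<in> T" "\<And>h. \<lbrakk>h \<in> S; p h < 0\<rbrakk> \<Longrightarrow> inv h \<in> T"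
    and mid: "midpoint_closed K {k \<in> carrier K. i k \<in> S} \<K>"
  shows "midpoint_closed G S layered"
  unfolding midpoint_closed_def
proof (intro ballI impI)
  fix C g h assume C: "C \<in> layered" and g: "g \<in> carrier G" and h: "h \<in> S"
    and gh: "g \<otimes> h \<in> C" "g \<otimes> inv h \<in> C"
  have hG: "h \<in> carrier G" using h S by blast
  have rule: "c \<otimes> inv h \<in> C" if "c \<in> C" "z \<in> C" "h \<in> T" "p z < p c - p h" for c z h
    using that C by (auto simp: layered_def)
  consider "p h > 0" | "p h < 0" | "p h = 0" by linarith
  then show "g \<in> C"
  proof cases
    case 1
    then show ?thesis using rule[OF gh T_S(1)[OF h]] g hG by (simp add: G.m_assoc)
  next
    case 2
    then show ?thesis using rule[OF gh(2,1) T_S(2)[OF h]] g hG by (simp add: G.m_assoc)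
  next
    case 3
    then have "h \<in> i ` carrier K" using hG by (simp add: exact kernel_def)
    then obtain k where k: "k \<in> carrier K" "h = i k" by blast
    have "fiber g C \<in> \<K>" using C g by (simp add: layered_def)
    moreover have "\<one>\<^bsub>K\<^esub> \<otimes>\<^bsub>K\<^esub> k \<in> fiber g C" "\<one>\<^bsub>K\<^esub> \<otimes>\<^bsub>K\<^esub> inv\<^bsub>K\<^esub> k \<in> fiber g C"
      using gh k by (simp_all add: fiber_def)
    ultimately have "\<one>\<^bsub>K\<^esub> \<in> fiber g C"
      using mid k h unfolding midpoint_closed_def by blast
    then show ?thesis using g by (simp add: fiber_def)
  qed
qed

end

section \<open>Numbering an extension by the integers\<close>

locale numbered_extension = z_extension K G i p
  for K :: "'b monoid" and G :: "'a monoid" (structure) and i p +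
  fixes \<nu> :: "'b \<Rightarrow> nat" and xs :: "'b list" and t :: 'a
  assumes \<nu>: "numbering K \<nu>" and xs: "spanning K xs" and t: "t \<in> carrier G" "p t = 1"
begin

lemma plain_K: "plain_group K"
  using K.is_group by (simp add: plain_group_iff)

lemma \<nu>_inj: "\<lbrakk>x \<in> carrier K; y \<in> carrier K\<rbrakk> \<Longrightarrow> \<nu> x = \<nu> y \<longleftrightarrow> x = y"
  and decidable_\<nu>: "decidable (\<nu> ` carrier K)"
  using \<nu> by (auto simp: numbering_def inj_on_eq_iff)

lemma t_pow [simp]: "t [^] (n::int) \<in> carrier G"
  using t by simp

lemma p_t_pow [simp]: "p (t [^] (n::int)) = n"
proof -
  have pow: "p (t [^] (k::nat)) = int k" for k
    using t by (induction k) simp_all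
  show ?thesis
  proof (cases "n < 0")
    case True
    then show ?thesis using t(1) pow[of "nat (- n)"] by (simp add: int_pow_def2[of _ _ n])
  next
    case False
    then have "n = int (nat n)" by simp
    then have "p (t [^] n) = p (t [^] nat n)" by (metis int_pow_int)
    then show ?thesis using pow[of "nat n"] False by linarith
  qed
qed

text \<open>
  The factor in \<open>K\<close> of the normal form \<open>g = t\<^sup>n \<otimes> i x\<close>, where \<open>n\<close> must be the height of \<open>g\<close>.
\<close>

definition part :: "'a \<Rightarrow> 'b" where
  "part g = inv_into (carrier K) i (inv (t [^] p g) \<otimes> g)"

lemma part_closed [simp]: "g \<in> carrier G \<Longrightarrow> part g \<in> carrier K"
  and normal_form: "g \<in> carrier G \<Longrightarrow> t [^] p g \<otimes> i (part g) = g"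
proof -
  assume g: "g \<in> carrier G"
  then have "inv (t [^] p g) \<otimes> g \<in> i ` carrier K"
    by (simp add: exact kernel_def)
  then have "part g \<in> carrier K" "i (part g) = inv (t [^] p g) \<otimes> g"
    unfolding part_def by (auto intro: inv_into_into f_inv_into_f)
  then show "part g \<in> carrier K" "t [^] p g \<otimes> i (part g) = g"
    using g by (simp_all add: G.m_assoc[symmetric])
qed

lemma i_eq_iff: "\<lbrakk>x \<in> carrier K; y \<in> carrier K\<rbrakk> \<Longrightarrow> i x = i y \<longleftrightarrow> x = y"
  using i_inj by (simp add: inj_on_eq_iff)

lemma part_unique:
  assumes "x \<in> carrier K" shows "part (t [^] (n::int) \<otimes> i x) = x"
proof -
  let ?g = "t [^] n \<otimes> i x"
  have "t [^] n \<otimes> i (part ?g) = ?g"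
    using normal_form[of ?g] assms by simp
  then show ?thesis using assms by (simp add: i_eq_iff)
qed

text \<open>
  The automorphism of \<open>K\<close> induced by conjugation in \<open>G\<close>. Multiplication of normal forms moves
  \<open>K\<close>-factors past powers of \<open>t\<close> by such automorphisms.
\<close>

definition conjugate :: "'a \<Rightarrow> 'b \<Rightarrow> 'b" where
  "conjugate a x = inv_into (carrier K) i (inv a \<otimes> i x \<otimes> a)"

lemma conjugate:
  assumes "a \<in> carrier G" "x \<in> carrier K"
  shows conjugate_closed: "conjugate a x \<in> carrier K" and i_conjugate: "i (conjugate a x) = inv a \<otimes> i x \<otimes> a"
proof -
  have "inv a \<otimes> i x \<otimes> a \<in> i ` carrier K"
    using assms by (simp add: exact kernel_def)
  then show "conjugate a x \<in> carrier K" "i (conjugate a x) = inv a \<otimes> i x \<otimes> a"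
    unfolding conjugate_def by (auto intro: inv_into_into f_inv_into_f)
qed

lemma conjugate_eqI:
  "\<lbrakk>a \<in> carrier G; x \<in> carrier K; y \<in> carrier K; i y = inv a \<otimes> i x \<otimes> a\<rbrakk> \<Longrightarrow> conjugate a x = y"
  using conjugate[of a x] i_eq_iff[of "conjugate a x" y] by simp

lemma conjugate_mult:
  assumes "a \<in> carrier G" "b \<in> carrier G" "x \<in> carrier K"
  shows "conjugate (a \<otimes> b) x = conjugate b (conjugate a x)"
  using assms by (intro conjugate_eqI) (simp_all add: conjugate_closed i_conjugate G.inv_mult_group G.m_assoc)

lemma conjugate_hom:
  assumes a: "a \<in> carrier G" shows "conjugate a \<in> hom K K"
proof (rule homI)
  fix x y assume xy: "x \<in> carrier K" "y \<in> carrier K"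
  have cancel: "a \<otimes> (inv a \<otimes> g) = g" if "g \<in> carrier G" for g
    using that a by (simp add: G.m_assoc[symmetric])
  show "conjugate a (x \<otimes>\<^bsub>K\<^esub> y) = conjugate a x \<otimes>\<^bsub>K\<^esub> conjugate a y"
    using a xy by (intro conjugate_eqI) (simp_all add: conjugate_closed i_conjugate G.m_assoc cancel)
qed (use a in \<open>simp add: conjugate_closed\<close>)

lemma conjugate_pow:
  assumes "a \<in> carrier G" "x \<in> carrier K"
  shows "conjugate (a [^] (k::nat)) x = (conjugate a ^^ k) x"
  using assms
proof (induction k)
  case 0
  then show ?case by (intro conjugate_eqI) simp_all
qed (simp add: conjugate_mult)

text \<open>
  At most one of \<open>nat n\<close> and \<open>nat (- n)\<close> is nonzero, so that the sign of \<open>n\<close> need not be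
  examined when computing with positive and negative parts of coded integers.
\<close>

lemma conjugate_t_pow:
  assumes "x \<in> carrier K"
  shows "conjugate (t [^] (n::int)) x = (conjugate (inv t) ^^ nat (- n)) ((conjugate t ^^ nat n) x)"
proof (cases "n < 0")
  case True
  then have "t [^] n = inv t [^] nat (- n)"
    by (simp only: int_pow_def2[of _ _ n] if_True G.nat_pow_inv[OF t(1)])
  then have "conjugate (t [^] n) x = (conjugate (inv t) ^^ nat (- n)) x"
    using conjugate_pow[OF G.inv_closed[OF t(1)] assms] by (simp only:)
  with True show ?thesis by simp
next
  case False
  then have "n = int (nat n)" by simp
  then have "t [^] n = t [^] nat n" by (metis int_pow_int)
  then have "conjugate (t [^] n) x = (conjugate t ^^ nat n) x"
    using conjugate_pow[OF t(1) assms] by (simp only:)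
  with False show ?thesis by simp
qed

lemma part_mult:
  assumes "g \<in> carrier G" "h \<in> carrier G"
  shows "part (g \<otimes> h) = conjugate (t [^] p h) (part g) \<otimes>\<^bsub>K\<^esub> part h"
proof -
  let ?x = "part g" and ?y = "part h"
  have cancel: "t [^] p h \<otimes> (inv (t [^] p h) \<otimes> u) = u" if "u \<in> carrier G" for u
    using that by (simp add: G.m_assoc[symmetric])
  have "g \<otimes> h = t [^] p g \<otimes> i ?x \<otimes> (t [^] p h \<otimes> i ?y)"
    using assms by (simp add: normal_form)
  also have "\<dots> = t [^] (p g + p h) \<otimes> i (conjugate (t [^] p h) ?x \<otimes>\<^bsub>K\<^esub> ?y)"
    using assms t by (simp add: G.int_pow_mult i_conjugate conjugate_closed G.m_assoc cancel)
  finally show ?thesis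
    using assms by (simp only: part_unique K.m_closed conjugate_closed part_closed t_pow)
qed

definition ext_num :: "'a \<Rightarrow> nat" where
  "ext_num g = cpair (int_encode (p g)) (\<nu> (part g))"

lemma ext_num_simps [simp]:
  "cfst (ext_num g) = int_encode (p g)" "csnd (ext_num g) = \<nu> (part g)"
  by (simp_all add: ext_num_def)

lemma ext_num_inj: "inj_on ext_num (carrier G)"
proof (rule inj_onI)
  fix g h assume gh: "g \<in> carrier G" "h \<in> carrier G" "ext_num g = ext_num h"
  then have "p g = p h" "part g = part h" by (auto simp: ext_num_def int_encode_eq \<nu>_inj)
  then show "g = h" using gh normal_form by metis
qed

lemma ext_num_range: "c \<in> ext_num ` carrier G \<longleftrightarrow> csnd c \<in> \<nu> ` carrier K"
proof
  assume "csnd c \<in> \<nu> ` carrier K"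
  then obtain x where x: "x \<in> carrier K" "csnd c = \<nu> x" by blast
  let ?g = "t [^] int_decode (cfst c) \<otimes> i x"
  have "ext_num ?g = c" using x by (simp add: ext_num_def part_unique flip: x(2))
  moreover have "?g \<in> carrier G" using x by simp
  ultimately show "c \<in> ext_num ` carrier G" by (metis imageI)
qed auto

text \<open>
  Conjugation by \<open>t\<close> and by its inverse are homomorphisms of the finitely generated group \<open>K\<close>,
  hence computable, and so are their iterates as functions of the number of iterations.
\<close>

lemma ext_num_mult:
  "\<exists>f. computable f \<and>
     (\<forall>g\<in>carrier G. \<forall>h\<in>carrier G. f (cpair (ext_num g) (ext_num h)) = ext_num (g \<otimes> h))"
proof -
  obtain m where m: "computable m"
      "\<And>x y. x \<in> carrier K \<Longrightarrow> y \<in> carrier K \<Longrightarrow> m (cpair (\<nu> x) (\<nu> y)) = \<nu> (x \<otimes>\<^bsub>K\<^esub> y)"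
    using \<nu> unfolding numbering_def by blast
  have "\<exists>f. computable f \<and> (\<forall>x\<in>carrier K. f (\<nu> x) = \<nu> (conjugate a x))" if "a \<in> carrier G" for a
    using plain_group.computable_hom[OF plain_K \<nu> \<nu> K.is_group xs conjugate_hom[OF that]] .
  then obtain c c' where c: "computable c" "\<And>x. x \<in> carrier K \<Longrightarrow> c (\<nu> x) = \<nu> (conjugate t x)"
    and c': "computable c'" "\<And>x. x \<in> carrier K \<Longrightarrow> c' (\<nu> x) = \<nu> (conjugate (inv t) x)"
    using t(1) G.inv_closed by metis
  have iter: "rec_nat (\<nu> x) (\<lambda>m r. d r) k = \<nu> ((conjugate a ^^ k) x) \<and> (conjugate a ^^ k) x \<in> carrier K"
    if "x \<in> carrier K" "a \<in> carrier G" "\<And>x. x \<in> carrier K \<Longrightarrow> d (\<nu> x) = \<nu> (conjugate a x)"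
    for x a d and k :: nat
    using that by (induction k) (simp_all add: conjugate_closed)
  define f where "f q = cpair
      (int_code (code_pos (cfst (cfst q)) + code_pos (cfst (csnd q)))
        (code_neg (cfst (cfst q)) + code_neg (cfst (csnd q))))
      (m (cpair
        (rec_nat (rec_nat (csnd (cfst q)) (\<lambda>m r. c r) (code_pos (cfst (csnd q))))
          (\<lambda>m r. c' r) (code_neg (cfst (csnd q))))
        (csnd (csnd q))))" for q
  have "computable f"
    unfolding f_def
    by (intro computable_comp[OF m(1)] computable_rec_nat computable_comp[OF c(1)]
        computable_comp[OF c'(1)] computable_int_code computable_code_pos computable_code_neg
        computable_basic)
  moreover have "f (cpair (ext_num g) (ext_num h)) = ext_num (g \<otimes> h)"
    if "g \<in> carrier G" "h \<in> carrier G" for g h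
  proof -
    have "int (nat a + nat b) - int (nat (- a) + nat (- b)) = a + b" for a b by simp
    then have "int_code (nat (p g) + nat (p h)) (nat (- p g) + nat (- p h)) = int_encode (p (g \<otimes> h))"
      using that by (simp only: int_code_eq p_mult)
    moreover have "rec_nat (rec_nat (\<nu> (part g)) (\<lambda>m r. c r) (nat (p h))) (\<lambda>m r. c' r) (nat (- p h))
        = \<nu> (conjugate (t [^] p h) (part g))"
      using iter[of "part g" t c] iter[of "(conjugate t ^^ nat (p h)) (part g)" "inv t" c'] c(2) c'(2) that t
      by (simp add: conjugate_t_pow)
    ultimately show ?thesis
      using that by (simp add: f_def code_pos_neg m(2) conjugate_closed part_mult ext_num_def del: p_mult)
  qed
  ultimately show ?thesis by blast
qed

lemma numbering_ext_num: "numbering G ext_num"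
  unfolding numbering_def
proof (intro conjI ext_num_inj ext_num_mult)
  show "decidable (ext_num ` carrier G)"
    unfolding decidable_iff ext_num_range
    by (intro decidable_pred_mem decidable_\<nu> computable_basic)
qed

lemma generate_extension:
  assumes gs: "set gs \<subseteq> carrier K" "generate K (set gs) = carrier K"
  shows "generate G (set (t # map i gs)) = carrier G"
proof (rule G.generateI[symmetric])
  interpret group_hom K G i by unfold_locales (rule i_hom)
  show "subgroup (carrier G) G" by (rule G.subgroup_self)
  show "set (t # map i gs) \<subseteq> carrier G" using t gs(1) by auto
  fix H assume H: "subgroup H G" "set (t # map i gs) \<subseteq> H"
  have "i ` carrier K = generate G (i ` set gs)" using generate_img[OF gs(1)] gs(2) by simp
  also have "\<dots> \<subseteq> H" using H by (intro G.generate_subgroup_incl) auto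
  finally have K: "i ` carrier K \<subseteq> H" .
  show "carrier G \<subseteq> H"
  proof
    fix g assume g: "g \<in> carrier G"
    have "t [^] p g \<in> H" using H by (intro G.subgroup_int_pow_closed) auto
    moreover have "i (part g) \<in> H" using K g by auto
    ultimately show "g \<in> H" using subgroup.m_closed[OF H(1)] normal_form[OF g] by metis
  qed
qed

end

locale decidable_layered_convexity =
  numbered_extension K G i p \<nu> xs t + layered_convexity K G i p \<K> T
  for K :: "'b monoid" and G :: "'a monoid" (structure) and i p \<nu> xs t \<K> T +
  assumes dec: "decidable ((\<lambda>C. set_encode (\<nu> ` C)) ` \<K>)"
begin

text \<open>
  The layer of a coded set at a given height consists of the second components of the pairs with
  given first component, and its code is computed as a bounded sum.
\<close>

lemma fiber_code:
  assumes C: "C \<in> Fpow (carrier G)" and D: "set_decode D = ext_num ` C"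
  shows "(\<Sum>x | x < D \<and> cpair n x \<in> ext_num ` C. 2 ^ x) =
      set_encode (\<nu> ` fiber (t [^] int_decode n) C)"
proof -
  have "{x. x < D \<and> cpair n x \<in> ext_num ` C} = \<nu> ` fiber (t [^] int_decode n) C" (is "?L = ?R")
  proof (intro equalityI subsetI)
    fix x assume "x \<in> ?L"
    then obtain g where g: "g \<in> C" "cpair n x = ext_num g" by blast
    then have "n = int_encode (p g)" "x = \<nu> (part g)" by (simp_all add: ext_num_def)
    moreover have "g \<in> carrier G" using g(1) C by (auto simp: Fpow_def)
    ultimately show "x \<in> ?R" using g(1) by (auto simp: fiber_def normal_form)
  next
    fix x assume "x \<in> ?R"
    then obtain y where y: "y \<in> carrier K" "t [^] int_decode n \<otimes> i y \<in> C" "x = \<nu> y"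
      by (auto simp: fiber_def)
    then have "ext_num (t [^] int_decode n \<otimes> i y) = cpair n x"
      by (simp add: ext_num_def part_unique)
    then have mem: "cpair n x \<in> ext_num ` C" using y(2) by (metis imageI)
    then have "cpair n x < D" using set_decode_less[of "cpair n x" D] D by simp
    then have "x < D" using le_cpair(2)[of x n] by linarith
    with mem show "x \<in> ?L" by simp
  qed
  then show ?thesis by (simp add: set_encode_def)
qed

text \<open>
  Only finitely many heights have to be examined: a pair is at least as large as its first
  component, so heights whose codes are not below the code of the set have empty fibers.
\<close>

lemma fibers_code_iff:
  assumes C: "C \<in> Fpow (carrier G)" and D: "set_decode D = ext_num ` C"
  shows "(\<forall>n<D. (\<Sum>x | x < D \<and> cpair n x \<in> set_decode D. 2 ^ x)
        \<in> (\<lambda>C. set_encode (\<nu> ` C)) ` \<K>) \<longleftrightarrow> (\<forall>g\<in>carrier G. fiber g C \<in> \<K>)"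
proof -
  have fin: "fiber g C \<in> Fpow (carrier K)" if "g \<in> carrier G" for g
    using C that finite_fiber by (auto simp: Fpow_def fiber_def)
  have code: "set_encode (\<nu> ` fiber g C) \<in> (\<lambda>C. set_encode (\<nu> ` C)) ` \<K> \<longleftrightarrow> fiber g C \<in> \<K>"
    if "g \<in> carrier G" for g
    using \<nu> convexityD(1)[OF \<K>] fin[OF that] by (intro code_mem_iff) (simp_all add: numbering_def)
  have "(\<forall>n<D. fiber (t [^] int_decode n) C \<in> \<K>) \<longleftrightarrow> (\<forall>g\<in>carrier G. fiber g C \<in> \<K>)"
  proof (intro iffI allI impI ballI)
    fix g assume *: "\<forall>n<D. fiber (t [^] int_decode n) C \<in> \<K>" and g: "g \<in> carrier G"
    let ?n = "int_encode (p g)"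
    have "fiber (t [^] p g) C \<in> \<K>"
    proof (cases "?n < D")
      case True
      then show ?thesis using * by force
    next
      case False
      have "fiber (t [^] p g) C = {}"
      proof (rule ccontr)
        assume "fiber (t [^] p g) C \<noteq> {}"
        then obtain y where y: "y \<in> carrier K" "t [^] p g \<otimes> i y \<in> C" by (auto simp: fiber_def)
        then have "ext_num (t [^] p g \<otimes> i y) = cpair ?n (\<nu> y)"
          by (simp add: ext_num_def part_unique)
        then have "cpair ?n (\<nu> y) \<in> set_decode D" using y(2) D by (metis imageI)
        then show False using set_decode_less le_cpair(1)[of ?n "\<nu> y"] False by force
      qed
      then show ?thesis using \<K>_empty by simp
    qed
    then show "fiber g C \<in> \<K>" using fiber_same_height[of "t [^] p g" g C] g by simp
  qed simp
  then show ?thesis by (simp add: D fiber_code[OF C D] code)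
qed

theorem decidable_layered: "decidable ((\<lambda>C. set_encode (ext_num ` C)) ` layered)"
proof -
  obtain f where f: "computable f"
      "\<And>g h. g \<in> carrier G \<Longrightarrow> h \<in> carrier G \<Longrightarrow> f (cpair (ext_num g) (ext_num h)) = ext_num (g \<otimes> h)"
    using ext_num_mult by blast
  define below where "below a b \<longleftrightarrow> code_pos a + code_neg b < code_pos b + code_neg a" for a b
  have below_iff: "below (int_encode a) (int_encode b) \<longleftrightarrow> a < b" for a b
    by (auto simp: below_def code_pos_neg)
  let ?P1 = "\<lambda>D. \<forall>c\<in>set_decode D. csnd c \<in> \<nu> ` carrier K"
  let ?P2 = "\<lambda>D. \<forall>n<D. (\<Sum>x | x < D \<and> cpair n x \<in> set_decode D. 2 ^ x)
      \<in> (\<lambda>C. set_encode (\<nu> ` C)) ` \<K>"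
  let ?P3 = "\<lambda>D. \<forall>h\<in>T. \<forall>c\<in>set_decode D. \<forall>z\<in>set_decode D.
      below (cfst z) (cfst (f (cpair c (ext_num (inv h))))) \<longrightarrow>
      f (cpair c (ext_num (inv h))) \<in> set_decode D"
  have "decidable_pred ?P1"
    by (intro decidable_pred_ball_set_decode decidable_pred_mem decidable_\<nu> computable_basic)
  moreover have "decidable_pred ?P2"
    by (intro decidable_pred_all_less decidable_pred_mem dec computable_sum_filter
        decidable_pred_basic)
  moreover have "decidable_pred ?P3"
    unfolding below_def using T(1)
    by (intro decidable_pred_ball_finite decidable_pred_ball_set_decode decidable_pred_basic
        computable_code_pos computable_code_neg computable_comp[OF f(1)])
  moreover have "D \<in> (\<lambda>C. set_encode (ext_num ` C)) ` layered \<longleftrightarrow> ?P1 D \<and> ?P2 D \<and> ?P3 D" for D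
  proof (cases "?P1 D")
    case True
    then have "set_decode D \<subseteq> ext_num ` carrier G" by (auto simp: ext_num_range)
    then obtain C where C: "C \<subseteq> carrier G" "set_decode D = ext_num ` C" by (meson subset_imageE)
    have "finite C"
      by (metis C finite_imageD finite_set_decode ext_num_inj inj_on_subset)
    then have C': "C \<in> Fpow (carrier G)" using C by (simp add: Fpow_def)
    have f_inv: "f (cpair (ext_num c) (ext_num (inv h))) = ext_num (c \<otimes> inv h)"
      if "c \<in> C" "h \<in> T" for c h
      using that C(1) T(2) by (intro f(2)) auto
    have mem: "ext_num g \<in> ext_num ` C \<longleftrightarrow> g \<in> C" if "g \<in> carrier G" for g
      using ext_num_inj C(1) that by (simp add: inj_on_image_mem_iff)
    have closed: "c \<otimes> inv h \<in> carrier G" "p (c \<otimes> inv h) = p c - p h" if "c \<in> C" "h \<in> T" for c h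
    proof -
      have "c \<in> carrier G" "h \<in> carrier G" using that C(1) T(2) by auto
      then show "c \<otimes> inv h \<in> carrier G" "p (c \<otimes> inv h) = p c - p h" by simp_all
    qed
    have "?P3 D \<longleftrightarrow> (\<forall>h\<in>T. \<forall>c\<in>C. \<forall>z\<in>C. p z < p c - p h \<longrightarrow> c \<otimes> inv h \<in> C)"
      by (simp add: C(2) f_inv below_iff closed mem cong: ball_cong)
    then have "?P3 D \<longleftrightarrow> (\<forall>c\<in>C. \<forall>z\<in>C. \<forall>h\<in>T. p z < p c - p h \<longrightarrow> c \<otimes> inv h \<in> C)"
      by blast
    then have "C \<in> layered \<longleftrightarrow> ?P2 D \<and> ?P3 D"
      unfolding fibers_code_iff[OF C' C(2)] by (simp add: layered_def C')
    moreover have "D = set_encode (ext_num ` C)" by (metis C(2) set_decode_inverse)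
    moreover have "layered \<subseteq> Fpow (carrier G)" by (auto simp: layered_def)
    ultimately show ?thesis
      using True code_mem_iff[OF ext_num_inj \<open>layered \<subseteq> _\<close> C'] by simp
  next
    case False
    have "set_decode D \<subseteq> ext_num ` carrier G" if "D = set_encode (ext_num ` C)" "C \<in> layered" for C
      using that by (auto simp: layered_def Fpow_def subset_iff)
    then show ?thesis using False ext_num_range by blast
  qed
  ultimately show ?thesis
    unfolding decidable_iff by (simp only: decidable_pred_conj)
qed

end

section \<open>Induction along the extensions\<close>

text \<open>
  The induction along the extensions carries a numbering that serves all finite sets \<open>S\<close> at
  once, since the set needed in \<open>K\<close> depends on the set given in \<open>G\<close>.
\<close>

definition convex_numbering :: "'a monoid \<Rightarrow> ('a \<Rightarrow> nat) \<Rightarrow> bool" where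
  "convex_numbering G \<nu> \<longleftrightarrow> numbering G \<nu> \<and>
     (\<forall>S. finite S \<and> S \<subseteq> carrier G \<longrightarrow>
        (\<exists>\<C>. convexity (carrier G) \<C> \<and> invariant_family G \<C> \<and> midpoint_closed G S \<C> \<and>
           decidable ((\<lambda>C. set_encode (\<nu> ` C)) ` \<C>)))"

definition decidably_convex :: "'a monoid \<Rightarrow> bool" where
  "decidably_convex G \<longleftrightarrow> group G \<and>
     (\<exists>gs. set gs \<subseteq> carrier G \<and> generate G (set gs) = carrier G) \<and>
     (\<exists>\<nu>. convex_numbering G \<nu>)"

lemma convex_numberingE:
  assumes "convex_numbering G \<nu>" "finite S" "S \<subseteq> carrier G"
  obtains \<C> where "convexity (carrier G) \<C>" "invariant_family G \<C>" "midpoint_closed G S \<C>"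
    "decidable ((\<lambda>C. set_encode (\<nu> ` C)) ` \<C>)"
  using assms unfolding convex_numbering_def by meson

lemma decidable_finite: "finite A \<Longrightarrow> decidable A"
proof -
  assume "finite A"
  then have "decidable_pred (\<lambda>x. \<not> (\<forall>a\<in>A. x \<noteq> a))"
    by (intro decidable_pred_ball_finite decidable_pred_basic)
  moreover have "(\<not> (\<forall>a\<in>A. x \<noteq> a)) \<longleftrightarrow> x \<in> A" for x by blast
  ultimately show ?thesis by (simp only: decidable_iff)
qed

lemma decidably_convex_trivial:
  assumes "trivial_group G" shows "decidably_convex G"
proof -
  have G: "group G" and carrier: "carrier G = {\<one>\<^bsub>G\<^esub>}"
    using assms by (auto simp: trivial_group_def)
  interpret group G by (rule G)
  let ?\<C> = "{{}, {\<one>\<^bsub>G\<^esub>}}"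
  have Fpow: "Fpow (carrier G) = ?\<C>" by (auto simp: carrier Fpow_def subset_singleton_iff)
  show ?thesis
    unfolding decidably_convex_def convex_numbering_def
  proof (intro conjI G exI[of _ "[]"] exI[of _ "\<lambda>_. 0"] allI impI exI[of _ ?\<C>])
    show "generate G (set []) = carrier G" by (simp add: carrier generate_empty)
    show "numbering G (\<lambda>_. 0)"
      unfolding numbering_def
    proof (intro conjI exI[of _ "\<lambda>_. 0"] computable_const)
      show "decidable ((\<lambda>_. 0) ` carrier G)" by (rule decidable_finite) (simp add: carrier)
    qed (simp_all add: carrier)
    show "convexity (carrier G) ?\<C>"
      unfolding convexity_def
    proof (intro conjI ballI allI impI)
      show "\<Inter>\<A> \<in> ?\<C>" if "\<A> \<subseteq> ?\<C>" "\<A> \<noteq> {}" for \<A>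
        using that by blast
    qed (auto simp: Fpow_def carrier)
    show "invariant_family G ?\<C>" by (auto simp: invariant_family_def carrier l_coset_def)
    show "midpoint_closed G S ?\<C>" if "finite S \<and> S \<subseteq> carrier G" for S
      using that by (auto simp: midpoint_closed_def carrier)
    show "decidable ((\<lambda>C. set_encode ((\<lambda>_. 0) ` C)) ` ?\<C>)" by (rule decidable_finite) simp
  qed simp
qed

lemma decidably_convex_extension:
  fixes K :: "'b monoid" and G :: "'a monoid" (structure)
  assumes K: "decidably_convex K" and G: "group G" and i: "i \<in> mon K G"
    and p: "p \<in> epi G integer_group" and exact: "i ` carrier K = kernel G integer_group p"
  shows "decidably_convex G"
proof -
  obtain gs \<nu> where gs: "set gs \<subseteq> carrier K" "generate K (set gs) = carrier K"
    and \<nu>_convex: "convex_numbering K \<nu>" and Kg: "group K"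
    using K unfolding decidably_convex_def by blast
  have \<nu>: "numbering K \<nu>" using \<nu>_convex by (simp add: convex_numbering_def)
  interpret z_extension K G i p
    using Kg G i p exact by (simp add: z_extension_def z_extension_axioms_def)
  have "plain_group K" using Kg by (simp add: plain_group_iff)
  then obtain xs where xs: "spanning K xs"
    using plain_group.spanning_signed_letters[OF _ gs] by blast
  obtain t where t: "t \<in> carrier G" "p t = 1" using p_surj by blast
  interpret numbered_extension K G i p \<nu> xs t
    by unfold_locales (rule \<nu> xs t)+
  show ?thesis
    unfolding decidably_convex_def convex_numbering_def
  proof (intro conjI G exI[of _ "t # map i gs"] exI[of _ ext_num] allI impI)
    show "set (t # map i gs) \<subseteq> carrier G" using t gs(1) by auto
    show "generate G (set (t # map i gs)) = carrier G" by (rule generate_extension[OF gs])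
    show "numbering G ext_num" by (rule numbering_ext_num)
    fix S assume S: "finite S \<and> S \<subseteq> carrier G"
    let ?S\<^sub>K = "{k \<in> carrier K. i k \<in> S}"
    have "finite ?S\<^sub>K"
    proof (rule finite_subset)
      show "?S\<^sub>K \<subseteq> fiber \<one> S" by (auto simp: fiber_def)
    qed (use finite_fiber[of S \<one>] S in simp)
    then obtain \<K> where base: "convexity (carrier K) \<K>" "invariant_family K \<K>"
        "midpoint_closed K ?S\<^sub>K \<K>" "decidable ((\<lambda>C. set_encode (\<nu> ` C)) ` \<K>)"
      by (rule convex_numberingE[OF \<nu>_convex]) auto
    define T where "T = {h \<in> S \<union> m_inv G ` S. p h > 0}"
    interpret decidable_layered_convexity K G i p \<nu> xs t \<K> T
    proof unfold_locales
      show "finite T" "T \<subseteq> carrier G" "\<And>h. h \<in> T \<Longrightarrow> p h > 0"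
        using S by (auto simp: T_def)
    qed (use base in simp_all)
    have "midpoint_closed G S layered"
    proof (rule midpoint_closed_layered)
      show "S \<subseteq> carrier G" using S by simp
      show "h \<in> T" if "h \<in> S" "p h > 0" for h using that by (simp add: T_def)
      show "inv h \<in> T" if "h \<in> S" "p h < 0" for h using that S by (auto simp: T_def)
    qed (rule base(3))
    then show "\<exists>\<C>. convexity (carrier G) \<C> \<and> invariant_family G \<C> \<and> midpoint_closed G S \<C> \<and>
        decidable ((\<lambda>C. set_encode (ext_num ` C)) ` \<C>)"
      using convexity_layered invariant_layered decidable_layered by blast
  qed
qed

lemma decidably_convex_strongly_polycyclic:
  "strongly_polycyclic G \<Longrightarrow> decidably_convex G"
proof (induction rule: strongly_polycyclic.induct)
  case (extension K G i p)
  show ?case by (rule decidably_convex_extension[OF extension.IH extension.hyps(2,4-6)])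
qed (rule decidably_convex_trivial)

theorem corollary56:
  fixes G :: "'a monoid" and S :: "'a set"
  assumes "strongly_polycyclic G"
    and "finite S" and "S \<subseteq> carrier G"
  shows "\<exists>\<C> \<tau>. convex_geometry G \<C> \<tau> \<and> invariant_family G \<C> \<and>
           midpointed G S \<tau> \<and> decidable_family G \<C>"
proof -
  obtain gs \<nu> where G: "group G" and gs: "set gs \<subseteq> carrier G" "generate G (set gs) = carrier G"
    and \<nu>_convex: "convex_numbering G \<nu>"
    using decidably_convex_strongly_polycyclic[OF assms(1)] unfolding decidably_convex_def by blast
  have \<nu>: "numbering G \<nu>" using \<nu>_convex by (simp add: convex_numbering_def)
  obtain \<C> where \<C>: "convexity (carrier G) \<C>" "invariant_family G \<C>" "midpoint_closed G S \<C>"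
      "decidable ((\<lambda>C. set_encode (\<nu> ` C)) ` \<C>)"
    using convex_numberingE[OF \<nu>_convex assms(2,3)] .
  interpret plain_group G using G by (simp add: plain_group_iff)
  have "decidable_family G \<C>"
    unfolding decidable_family_def
  proof (intro conjI allI impI)
    show "fg_decidable_word_problem G" by (rule numbering_word_problem[OF \<nu> gs])
    show "\<exists>enc. computable_encoding G enc" using computable_encoding_unary[OF \<nu>] by blast
    fix enc assume "computable_encoding G enc"
    from decidable_codes_transfer[OF \<nu> computable_encoding_numbering[OF this]
        spanning_signed_letters[OF gs] convexityD(1)[OF \<C>(1)] \<C>(4)]
    show "decidable ((\<lambda>C. set_encode (list_encode ` enc ` C)) ` \<C>)" by (simp add: image_image)
  qed
  with \<C> convex_geometry_hull midpointed_hull show ?thesis by blast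
qed

end
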